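(* Let $(R,\mathfrak{m})$ be a Cohen-Macaulay local ring and let $\mathfrak{p}\in\operatorname{Spec}(R)$ be such that $\operatorname{height}(\mathfrak{p})=1$ and $\operatorname{index}(R_{\mathfrak{p}})$ is finite. Let $s=\operatorname{index}(R_{\mathfrak{p}})$ and let $x\in\mathfrak{p}^{(t)}\setminus\mathfrak{p}^{(t+1)}$ be a nonzerodivisor, where $t\ge1$. If the map induced by multiplication by $x$, \[ \overline{x}:\mathfrak{p}^{(i-1)}/\mathfrak{p}^{(i)}\longrightarrow\mathfrak{p}^{(i+t-1)}/\mathfrak{p}^{(i+t)}, \] is injective for $1\le i\le s$, then \[ g\ell\ell(R_{\mathfrak{p}})\leq\operatorname{index}(R_{\mathfrak{p}})+t-1. \]
   Context: Local rings are commutative and Noetherian. For $n\ge1$, $\mathfrak{p}^{(n)}:=R\cap\mathfrak{p}^nR_{\mathfrak{p}}$ (the preimage in $R$ of $\mathfrak{p}^nR_{\mathfrak{p}}$) is the $n$-th symbolic power of $\mathfrak{p}$, and $\mathfrak{p}^{(0)}=R$. For a Cohen-Macaulay local ring $(S,\mathfrak{n})$ and a finitely generated $S$-module $M$, Auslander's invariant $\delta_S(M)$ is the smallest non-negative integer $n$ such that there is a surjective $S$-linear map $X\oplus S^n\to M$ with $X$ a maximal Cohen-Macaulay $S$-module having no free direct summand ($X=0$ allowed). One has $0\le\delta_S(S/\mathfrak{n}^n)\le\delta_S(S/\mathfrak{n}^{n+1})\le 1$ for all $n\ge1$, and $\operatorname{index}(S):=\inf\{n\ge 1 \mid \delta_S(S/\mathfrak{n}^n)=1\}$.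 The generalized Loewy length $g\ell\ell(S)$ is the smallest positive integer $n$ such that $\mathfrak{n}^n$ is contained in the ideal generated by some system of parameters of $S$. *)

theory Defs
  imports "HOL-Algebra.Algebra" "HOL-Library.Extended_Nat"
begin

section \<open>Local rings, dimension and systems of parameters\<close>

definition noeth_local_ring :: "('a, 'b) ring_scheme \<Rightarrow> bool"
  where "noeth_local_ring R \<longleftrightarrow> cring R \<and> noetherian_ring R \<and> (\<exists>!m. maximalideal m R)"

definition max_ideal :: "('a, 'b) ring_scheme \<Rightarrow> 'a set"
  where "max_ideal R = (THE m. maximalideal m R)"

text \<open>Powers in the monoid of ideals under the ideal product; in particular the zeroth power
  of an ideal is the whole ring.\<close>

definition ideal_power :: "('a, 'b) ring_scheme \<Rightarrow> 'a set \<Rightarrow> nat \<Rightarrow> 'a set"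
  where "ideal_power R I n = I [^]\<^bsub>ideals_set R\<^esub> n"

text \<open>A chain of \<open>n + 1\<close> primes has length \<open>n\<close>.\<close>

definition prime_chain :: "('a, 'b) ring_scheme \<Rightarrow> 'a set list \<Rightarrow> bool"
  where "prime_chain R qs \<longleftrightarrow>
    qs \<noteq> [] \<and> (\<forall>q \<in> set qs. primeideal q R) \<and> sorted_wrt (\<subset>) qs"

definition krull_dim :: "('a, 'b) ring_scheme \<Rightarrow> enat"
  where "krull_dim R = (SUP qs \<in> {qs. prime_chain R qs}. enat (length qs - 1))"

definition height :: "('a, 'b) ring_scheme \<Rightarrow> 'a set \<Rightarrow> enat"
  where "height R p = (SUP qs \<in> {qs. prime_chain R qs \<and> last qs = p}. enat (length qs - 1))"

text \<open>A system of parameters of a local ring consists of \<open>dim S\<close> elements of the maximal ideal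
  generating an ideal that is primary to it, i.e. that contains one of its powers.\<close>

definition system_of_parameters :: "('a, 'b) ring_scheme \<Rightarrow> 'a list \<Rightarrow> bool"
  where "system_of_parameters S xs \<longleftrightarrow>
    set xs \<subseteq> max_ideal S \<and> enat (length xs) = krull_dim S \<and>
    (\<exists>k. ideal_power S (max_ideal S) k \<subseteq> Idl\<^bsub>S\<^esub> (set xs))"

definition gen_loewy_length :: "('a, 'b) ring_scheme \<Rightarrow> enat"
  where "gen_loewy_length S = Inf (enat ` {n. 1 \<le> n \<and>
    (\<exists>xs. system_of_parameters S xs \<and> ideal_power S (max_ideal S) n \<subseteq> Idl\<^bsub>S\<^esub> (set xs))})"


section \<open>Modules\<close>

text \<open>The record of modules extends that of rings; the fields \<open>mult\<close> and \<open>one\<close>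
  play no role for modules.\<close>

definition regular_module :: "('s, 'b) ring_scheme \<Rightarrow> ('s, 's) module"
  where "regular_module S = \<lparr>carrier = carrier S, monoid.mult = (\<otimes>\<^bsub>S\<^esub>), one = \<one>\<^bsub>S\<^esub>,
    ring.zero = \<zero>\<^bsub>S\<^esub>, add = (\<oplus>\<^bsub>S\<^esub>), smult = (\<otimes>\<^bsub>S\<^esub>)\<rparr>"

definition free_module :: "('s, 'b) ring_scheme \<Rightarrow> nat \<Rightarrow> ('s, nat \<Rightarrow> 's) module"
  where "free_module S n = \<lparr>carrier = (\<Pi>\<^sub>E i \<in> {..<n}. carrier S),
    monoid.mult = undefined, one = undefined,
    ring.zero = (\<lambda>i \<in> {..<n}. \<zero>\<^bsub>S\<^esub>), add = (\<lambda>v w. \<lambda>i \<in> {..<n}. v i \<oplus>\<^bsub>S\<^esub> w i),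
    smult = (\<lambda>a v. \<lambda>i \<in> {..<n}. a \<otimes>\<^bsub>S\<^esub> v i)\<rparr>"

definition direct_sum :: "('s, 'm) module \<Rightarrow> ('s, 'n) module \<Rightarrow> ('s, 'm \<times> 'n) module"
  where "direct_sum M N = \<lparr>carrier = carrier M \<times> carrier N,
    monoid.mult = undefined, one = undefined,
    ring.zero = (\<zero>\<^bsub>M\<^esub>, \<zero>\<^bsub>N\<^esub>), add = (\<lambda>u v. (fst u \<oplus>\<^bsub>M\<^esub> fst v, snd u \<oplus>\<^bsub>N\<^esub> snd v)),
    smult = (\<lambda>a u. (a \<odot>\<^bsub>M\<^esub> fst u, a \<odot>\<^bsub>N\<^esub> snd u))\<rparr>"

text \<open>Adding \<open>N\<close> in the scalar multiplication makes the result a coset: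
  \<open>N + a (N + v) = N + a v\<close>.\<close>

definition quotient_module :: "('s, 'm) module \<Rightarrow> 'm set \<Rightarrow> ('s, 'm set) module"
  where "quotient_module M N = \<lparr>carrier = a_rcosets\<^bsub>M\<^esub> N,
    monoid.mult = undefined, one = undefined,
    ring.zero = N, add = set_add M, smult = (\<lambda>a C. N <+>\<^bsub>M\<^esub> (smult M a ` C))\<rparr>"

definition module_hom ::
    "('s, 'b) ring_scheme \<Rightarrow> ('s, 'm) module \<Rightarrow> ('s, 'n) module \<Rightarrow> ('m \<Rightarrow> 'n) set"
  where "module_hom S M N = {h \<in> carrier M \<rightarrow> carrier N.
    (\<forall>u \<in> carrier M. \<forall>v \<in> carrier M. h (u \<oplus>\<^bsub>M\<^esub> v) = h u \<oplus>\<^bsub>N\<^esub> h v) \<and>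
    (\<forall>a \<in> carrier S. \<forall>v \<in> carrier M. h (a \<odot>\<^bsub>M\<^esub> v) = a \<odot>\<^bsub>N\<^esub> h v)}"

definition module_isomorphic ::
    "('s, 'b) ring_scheme \<Rightarrow> ('s, 'm) module \<Rightarrow> ('s, 'n) module \<Rightarrow> bool"
  where "module_isomorphic S M N \<longleftrightarrow>
    (\<exists>h \<in> module_hom S M N. bij_betw h (carrier M) (carrier N))"

definition fin_gen_module :: "('s, 'b) ring_scheme \<Rightarrow> ('s, 'm) module \<Rightarrow> bool"
  where "fin_gen_module S M \<longleftrightarrow> module S M \<and>
    (\<exists>A \<subseteq> carrier M. finite A \<and>
      (\<forall>v \<in> carrier M. \<exists>c \<in> A \<rightarrow> carrier S. v = (\<Oplus>\<^bsub>M\<^esub> u \<in> A. c u \<odot>\<^bsub>M\<^esub> u)))"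

definition submodule_span ::
    "('s, 'b) ring_scheme \<Rightarrow> ('s, 'm) module \<Rightarrow> 'm set \<Rightarrow> 'm set"
  where "submodule_span S M A = \<Inter> {N. submodule N S M \<and> A \<subseteq> N}"

text \<open>\<open>scaled_submodule S M B\<close> is the submodule \<open>(B) M\<close> of \<open>M\<close>, where \<open>(B)\<close>
  is the ideal generated by \<open>B\<close>.\<close>

definition scaled_submodule ::
    "('s, 'b) ring_scheme \<Rightarrow> ('s, 'm) module \<Rightarrow> 's set \<Rightarrow> 'm set"
  where "scaled_submodule S M B =
    submodule_span S M {a \<odot>\<^bsub>M\<^esub> v | a v. a \<in> B \<and> v \<in> carrier M}"


section \<open>Depth and maximal Cohen-Macaulay modules\<close>

definition nonzerodivisor_on :: "('s, 'm) module \<Rightarrow> 's \<Rightarrow> bool"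
  where "nonzerodivisor_on M a \<longleftrightarrow> (\<forall>v \<in> carrier M. a \<odot>\<^bsub>M\<^esub> v = \<zero>\<^bsub>M\<^esub> \<longrightarrow> v = \<zero>\<^bsub>M\<^esub>)"

definition regular_sequence ::
    "('s, 'b) ring_scheme \<Rightarrow> ('s, 'm) module \<Rightarrow> 's list \<Rightarrow> bool"
  where "regular_sequence S M xs \<longleftrightarrow> set xs \<subseteq> carrier S \<and>
    (\<forall>i < length xs.
      nonzerodivisor_on (quotient_module M (scaled_submodule S M (set (take i xs)))) (xs ! i)) \<and>
    scaled_submodule S M (set xs) \<noteq> carrier M"

definition depth :: "('s, 'b) ring_scheme \<Rightarrow> ('s, 'm) module \<Rightarrow> enat"
  where "depth S M =
    (SUP xs \<in> {xs. set xs \<subseteq> max_ideal S \<and> regular_sequence S M xs}. enat (length xs))"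

text \<open>The zero module counts as maximal Cohen-Macaulay.\<close>

definition max_cohen_macaulay :: "('s, 'b) ring_scheme \<Rightarrow> ('s, 'm) module \<Rightarrow> bool"
  where "max_cohen_macaulay S M \<longleftrightarrow>
    fin_gen_module S M \<and> (carrier M = {\<zero>\<^bsub>M\<^esub>} \<or> depth S M = krull_dim S)"

definition cohen_macaulay_local_ring :: "('s, 'b) ring_scheme \<Rightarrow> bool"
  where "cohen_macaulay_local_ring S \<longleftrightarrow>
    noeth_local_ring S \<and> depth S (regular_module S) = krull_dim S"

definition has_free_summand :: "('s, 'b) ring_scheme \<Rightarrow> ('s, 'm) module \<Rightarrow> bool"
  where "has_free_summand S M \<longleftrightarrow>
    (\<exists>F N. submodule F S M \<and> submodule N S M \<and>
      F \<inter> N = {\<zero>\<^bsub>M\<^esub>} \<and> F <+>\<^bsub>M\<^esub> N = carrier M \<and>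
      (\<exists>k \<ge> 1. module_isomorphic S (free_module S k) (M\<lparr>carrier := F\<rparr>)))"


section \<open>Auslander's delta invariant and the index\<close>

text \<open>The existential quantifier over modules \<open>L\<close> has to range over a fixed type. The type
  \<open>(nat \<Rightarrow> 's) set\<close> below is large enough: every finitely generated \<open>S\<close>-module, of whatever
  type, is isomorphic to a module on this type, and the conditions imposed on \<open>L\<close> are invariant
  under isomorphism.\<close>

lemma fin_gen_module_representative:
  fixes S :: "('s, 'b) ring_scheme" and M :: "('s, 'm) module"
  assumes fg: "fin_gen_module S M"
  shows "\<exists>L :: ('s, (nat \<Rightarrow> 's) set) module. fin_gen_module S L \<and> module_isomorphic S M L"
proof -
  interpret module S M using fg by (simp add: fin_gen_module_def)
  obtain A where A: "A \<subseteq> carrier M" "finite A"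
    and gen: "\<And>v. v \<in> carrier M \<Longrightarrow> \<exists>c \<in> A \<rightarrow> carrier S. v = (\<Oplus>\<^bsub>M\<^esub> u \<in> A. c u \<odot>\<^bsub>M\<^esub> u)"
    using fg unfolding fin_gen_module_def by meson
  obtain f :: "'m \<Rightarrow> nat" where f: "inj_on f A"
    using finite_imp_inj_to_nat_seg[OF A(2)] that by (elim exE conjE) assumption
  define h where "h v = {d :: nat \<Rightarrow> 's. (\<lambda>u. d (f u)) \<in> A \<rightarrow> carrier S \<and>
    v = (\<Oplus>\<^bsub>M\<^esub> u \<in> A. d (f u) \<odot>\<^bsub>M\<^esub> u)}" for v
  have ne: "h v \<noteq> {}" if v: "v \<in> carrier M" for v
  proof -
    obtain c where c: "c \<in> A \<rightarrow> carrier S" "v = (\<Oplus>\<^bsub>M\<^esub> u \<in> A. c u \<odot>\<^bsub>M\<^esub> u)"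
      using gen[OF v] by (elim bexE)
    have cf: "c (inv_into A f (f u)) = c u" if "u \<in> A" for u using f that by simp
    have "(\<Oplus>\<^bsub>M\<^esub> u \<in> A. c (inv_into A f (f u)) \<odot>\<^bsub>M\<^esub> u) = (\<Oplus>\<^bsub>M\<^esub> u \<in> A. c u \<odot>\<^bsub>M\<^esub> u)"
      using A c by (intro M.add.finprod_cong') (auto simp: cf)
    then have "c \<circ> inv_into A f \<in> h v" using c cf by (auto simp: h_def Pi_iff)
    then show ?thesis by blast
  qed
  have inj: "inj_on h (carrier M)"
  proof (rule inj_onI)
    fix v w assume vw: "v \<in> carrier M" "w \<in> carrier M" "h v = h w"
    then obtain d where "d \<in> h v" using ne by blast
    with vw(3) have "d \<in> h v" "d \<in> h w" by auto
    then show "v = w" by (simp add: h_def)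
  qed
  define g where "g = inv_into (carrier M) h"
  have gh [simp]: "g (h v) = v" if "v \<in> carrier M" for v
    using inj that by (simp add: g_def)
  define L :: "('s, (nat \<Rightarrow> 's) set) module" where
    "L = \<lparr>carrier = h ` carrier M, monoid.mult = undefined, one = undefined,
      ring.zero = h \<zero>\<^bsub>M\<^esub>, add = (\<lambda>U V. h (g U \<oplus>\<^bsub>M\<^esub> g V)), smult = (\<lambda>a U. h (a \<odot>\<^bsub>M\<^esub> g U))\<rparr>"
  have L [simp]: "carrier L = h ` carrier M" "\<zero>\<^bsub>L\<^esub> = h \<zero>\<^bsub>M\<^esub>"
    "U \<oplus>\<^bsub>L\<^esub> V = h (g U \<oplus>\<^bsub>M\<^esub> g V)" "a \<odot>\<^bsub>L\<^esub> U = h (a \<odot>\<^bsub>M\<^esub> g U)" for U V a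
    by (simp_all add: L_def)
  have grp: "abelian_group L"
  proof (rule abelian_groupI)
    fix U assume "U \<in> carrier L"
    then obtain v where v: "v \<in> carrier M" "U = h v" by auto
    show "\<exists>V \<in> carrier L. V \<oplus>\<^bsub>L\<^esub> U = \<zero>\<^bsub>L\<^esub>"
      using v by (intro bexI[of _ "h (\<ominus>\<^bsub>M\<^esub> v)"]) (auto simp: M.l_neg)
  qed (auto simp: M.a_ac)
  have mod: "module S L"
    by (rule moduleI[OF R.is_cring grp])
      (auto simp: smult_l_distr smult_r_distr smult_assoc1)
  interpret L: module S L by (rule mod)
  have hom: "h \<in> module_hom S M L" by (auto simp: module_hom_def)
  have hsum: "h (\<Oplus>\<^bsub>M\<^esub> u \<in> B. k u) = (\<Oplus>\<^bsub>L\<^esub> u \<in> B. h (k u))"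
    if "finite B" "k \<in> B \<rightarrow> carrier M" for B :: "'m set" and k
    using that
  proof (induction B)
    case empty
    show ?case by (simp only: M.finsum_empty L.M.finsum_empty L)
  next
    case (insert b B)
    then have k: "k b \<in> carrier M" "k \<in> B \<rightarrow> carrier M" by auto
    then have hk: "(\<lambda>u. h (k u)) \<in> B \<rightarrow> carrier L" "h (k b) \<in> carrier L" by auto
    have "h (\<Oplus>\<^bsub>M\<^esub> u \<in> insert b B. k u) = h (k b \<oplus>\<^bsub>M\<^esub> (\<Oplus>\<^bsub>M\<^esub> u \<in> B. k u))"
      using insert k by simp
    also have "\<dots> = h (k b) \<oplus>\<^bsub>L\<^esub> h (\<Oplus>\<^bsub>M\<^esub> u \<in> B. k u)"
      using k by (simp add: M.finsum_closed)
    also have "\<dots> = h (k b) \<oplus>\<^bsub>L\<^esub> (\<Oplus>\<^bsub>L\<^esub> u \<in> B. h (k u))"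
      using insert k by simp
    also have "\<dots> = (\<Oplus>\<^bsub>L\<^esub> u \<in> insert b B. h (k u))"
      using L.M.finsum_insert[OF insert.hyps hk] by simp
    finally show ?case .
  qed
  have "\<exists>c \<in> h ` A \<rightarrow> carrier S. U = (\<Oplus>\<^bsub>L\<^esub> u \<in> h ` A. c u \<odot>\<^bsub>L\<^esub> u)"
    if U: "U \<in> carrier L" for U
  proof -
    obtain v where v: "v \<in> carrier M" "U = h v" using U by auto
    obtain c where c: "c \<in> A \<rightarrow> carrier S" "v = (\<Oplus>\<^bsub>M\<^esub> u \<in> A. c u \<odot>\<^bsub>M\<^esub> u)"
      using gen[OF v(1)] by (elim bexE)
    have gA: "g (h u) = u" if "u \<in> A" for u using A that by auto
    have cl: "(\<lambda>u. c u \<odot>\<^bsub>M\<^esub> u) \<in> A \<rightarrow> carrier M" using A c by auto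
    have injA: "inj_on h A" using inj A(1) by (rule inj_on_subset)
    have "(\<Oplus>\<^bsub>L\<^esub> w \<in> h ` A. c (g w) \<odot>\<^bsub>L\<^esub> w) = (\<Oplus>\<^bsub>L\<^esub> u \<in> A. c (g (h u)) \<odot>\<^bsub>L\<^esub> h u)"
      using A c injA by (intro L.M.add.finprod_reindex) (auto simp: Pi_iff gA subset_iff)
    also have "\<dots> = (\<Oplus>\<^bsub>L\<^esub> u \<in> A. h (c u \<odot>\<^bsub>M\<^esub> u))"
      using A c by (intro L.M.add.finprod_cong') (auto simp: gA Pi_iff subset_iff)
    also have "\<dots> = U" using hsum[OF A(2) cl] v c by simp
    finally show ?thesis using c(1) by (intro bexI[of _ "c \<circ> g"]) (auto simp: gA Pi_iff)
  qed
  then have "fin_gen_module S L"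
    using mod A unfolding fin_gen_module_def by (intro conjI exI[of _ "h ` A"]) auto
  moreover have "module_isomorphic S M L"
    using hom inj unfolding module_isomorphic_def bij_betw_def by (intro bexI[of _ h]) auto
  ultimately show ?thesis by blast
qed

text \<open>The infimum of the empty set is \<open>\<infinity>\<close>.\<close>

definition auslander_delta :: "('s, 'b) ring_scheme \<Rightarrow> ('s, 'm) module \<Rightarrow> enat"
  where "auslander_delta S M = Inf (enat ` {n.
    \<exists>L :: ('s, (nat \<Rightarrow> 's) set) module.
      max_cohen_macaulay S L \<and> \<not> has_free_summand S L \<and>
      (\<exists>h \<in> module_hom S (direct_sum L (free_module S n)) M.
        h ` carrier (direct_sum L (free_module S n)) = carrier M)})"

definition auslander_index :: "('s, 'b) ring_scheme \<Rightarrow> enat"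
  where "auslander_index S = Inf (enat ` {n. 1 \<le> n \<and>
    auslander_delta S (quotient_module (regular_module S) (ideal_power S (max_ideal S) n)) = 1})"


section \<open>Localization and symbolic powers\<close>

context
  fixes R :: "('a, 'b) ring_scheme" (structure) and S :: "'a set"
begin

definition frac_rel :: "(('a \<times> 'a) \<times> ('a \<times> 'a)) set"
  where "frac_rel = {((a, s), (b, t)). a \<in> carrier R \<and> s \<in> S \<and> b \<in> carrier R \<and> t \<in> S \<and>
    (\<exists>u \<in> S. u \<otimes> (t \<otimes> a) = u \<otimes> (s \<otimes> b))}"

definition fraction :: "'a \<Rightarrow> 'a \<Rightarrow> ('a \<times> 'a) set"
  where "fraction a s = frac_rel `` {(a, s)}"

definition localization :: "('a \<times> 'a) set ring"
  where "localization = \<lparr>carrier = (carrier R \<times> S) // frac_rel,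
    monoid.mult = (\<lambda>U V. \<Union>(a, s) \<in> U. \<Union>(b, t) \<in> V. fraction (a \<otimes> b) (s \<otimes> t)),
    one = fraction \<one> \<one>, ring.zero = fraction \<zero> \<one>,
    add = (\<lambda>U V. \<Union>(a, s) \<in> U. \<Union>(b, t) \<in> V. fraction (t \<otimes> a \<oplus> s \<otimes> b) (s \<otimes> t))\<rparr>"

end

lemma (in cring) localization_cring:
  assumes "submonoid S R"
  shows "cring (localization R S)"
    and "carrier (localization R S) = {fraction R S a s | a s. a \<in> carrier R \<and> s \<in> S}"
    and "\<And>a s b t. \<lbrakk>a \<in> carrier R; s \<in> S; b \<in> carrier R; t \<in> S\<rbrakk> \<Longrightarrow>
      fraction R S a s \<otimes>\<^bsub>localization R S\<^esub> fraction R S b t = fraction R S (a \<otimes> b) (s \<otimes> t)"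
    and "\<And>a s b t. \<lbrakk>a \<in> carrier R; s \<in> S; b \<in> carrier R; t \<in> S\<rbrakk> \<Longrightarrow>
      fraction R S a s \<oplus>\<^bsub>localization R S\<^esub> fraction R S b t = fraction R S (t \<otimes> a \<oplus> s \<otimes> b) (s \<otimes> t)"
proof -
  note SC = submonoid.mem_carrier[OF assms] and S1 = submonoid.one_closed[OF assms]
    and SM = submonoid.m_closed[OF assms]
  let ?F = "fraction R S" and ?Q = "localization R S"
  have trans: "((a, s), (c, r)) \<in> frac_rel R S"
    if "((a, s), (b, t)) \<in> frac_rel R S" "((b, t), (c, r)) \<in> frac_rel R S" for a s b t c r
  proof -
    from that obtain u w where u: "u \<in> S" "u \<otimes> (t \<otimes> a) = u \<otimes> (s \<otimes> b)"
      and w: "w \<in> S" "w \<otimes> (r \<otimes> b) = w \<otimes> (t \<otimes> c)"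
      and m: "a \<in> carrier R" "s \<in> S" "b \<in> carrier R" "t \<in> S" "c \<in> carrier R" "r \<in> S"
      by (auto simp: frac_rel_def)
    note cl = SC[OF u(1)] SC[OF w(1)] SC[OF m(2)] SC[OF m(4)] SC[OF m(6)] m(1,3,5)
    have "(u \<otimes> w \<otimes> t) \<otimes> (r \<otimes> a) = (w \<otimes> r) \<otimes> (u \<otimes> (t \<otimes> a))"
      using cl by (simp add: m_ac)
    also have "\<dots> = (u \<otimes> s) \<otimes> (w \<otimes> (r \<otimes> b))" using cl u by (simp add: m_ac)
    also have "\<dots> = (u \<otimes> w \<otimes> t) \<otimes> (s \<otimes> c)" using cl w by (simp add: m_ac)
    finally show ?thesis using m u(1) w(1) SM by (auto simp: frac_rel_def)
  qed
  have equiv: "equiv (carrier R \<times> S) (frac_rel R S)"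
  proof (rule equivI)
    show "refl_on (carrier R \<times> S) (frac_rel R S)"
      using S1 by (auto simp: refl_on_def frac_rel_def)
    show "sym (frac_rel R S)" by (auto simp: sym_def frac_rel_def intro: sym)
    show "trans (frac_rel R S)" using trans by (force simp: trans_def)
  qed (auto simp: frac_rel_def)
  have eqI: "?F a s = ?F b t" if "((a, s), (b, t)) \<in> frac_rel R S" for a s b t
    using equiv_class_eq[OF equiv that] by (simp add: fraction_def)
  have eqI': "?F a s = ?F b t" if "a \<in> carrier R" "b \<in> carrier R" "s \<in> S" "t \<in> S"
    "t \<otimes> a = s \<otimes> b" for a s b t
    using that S1 by (intro eqI) (auto simp: frac_rel_def)
  show carr: "carrier ?Q = {?F a s | a s. a \<in> carrier R \<and> s \<in> S}"
    by (auto simp: localization_def quotient_def fraction_def)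
  have memF: "(b, t) \<in> ?F a s \<longleftrightarrow> ((a, s), (b, t)) \<in> frac_rel R S" for a s b t
    by (simp add: fraction_def)
  have self: "(a, s) \<in> ?F a s" if "a \<in> carrier R" "s \<in> S" for a s
    using that S1 by (auto simp: memF frac_rel_def)
  show mult: "?F a s \<otimes>\<^bsub>?Q\<^esub> ?F b t = ?F (a \<otimes> b) (s \<otimes> t)"
    if m: "a \<in> carrier R" "s \<in> S" "b \<in> carrier R" "t \<in> S" for a s b t
  proof -
    have eq: "?F (a' \<otimes> b') (s' \<otimes> t') = ?F (a \<otimes> b) (s \<otimes> t)"
      if "(a', s') \<in> ?F a s" "(b', t') \<in> ?F b t" for a' s' b' t'
    proof -
      from that obtain u w where u: "u \<in> S" "u \<otimes> (s' \<otimes> a) = u \<otimes> (s \<otimes> a')"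
        and w: "w \<in> S" "w \<otimes> (t' \<otimes> b) = w \<otimes> (t \<otimes> b')"
        and m': "a' \<in> carrier R" "s' \<in> S" "b' \<in> carrier R" "t' \<in> S"
        by (auto simp: memF frac_rel_def)
      note cl = SC[OF u(1)] SC[OF w(1)] SC[OF m(2)] SC[OF m(4)] SC[OF m'(2)] SC[OF m'(4)]
        m(1,3) m'(1,3)
      have "(u \<otimes> w) \<otimes> ((s' \<otimes> t') \<otimes> (a \<otimes> b)) = (u \<otimes> (s' \<otimes> a)) \<otimes> (w \<otimes> (t' \<otimes> b))"
        using cl by (simp add: m_ac)
      also have "\<dots> = (u \<otimes> w) \<otimes> ((s \<otimes> t) \<otimes> (a' \<otimes> b'))"
        unfolding u(2) w(2) using cl by (simp add: m_ac)
      finally show ?thesis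
        using m m' u(1) w(1) SM by (intro eqI[symmetric]) (auto simp: frac_rel_def)
    qed
    have "?F a s \<otimes>\<^bsub>?Q\<^esub> ?F b t = (\<Union>(a', s') \<in> ?F a s. \<Union>(b', t') \<in> ?F b t. ?F (a' \<otimes> b') (s' \<otimes> t'))"
      by (simp add: localization_def)
    also have "\<dots> = (\<Union>z \<in> ?F a s. \<Union>z' \<in> ?F b t. ?F (a \<otimes> b) (s \<otimes> t))"
      using eq by (intro SUP_cong refl) (auto simp: case_prod_beta)
    also have "\<dots> = ?F (a \<otimes> b) (s \<otimes> t)" using self m by blast
    finally show ?thesis .
  qed
  show add: "?F a s \<oplus>\<^bsub>?Q\<^esub> ?F b t = ?F (t \<otimes> a \<oplus> s \<otimes> b) (s \<otimes> t)"
    if m: "a \<in> carrier R" "s \<in> S" "b \<in> carrier R" "t \<in> S" for a s b t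
  proof -
    have eq: "?F (t' \<otimes> a' \<oplus> s' \<otimes> b') (s' \<otimes> t') = ?F (t \<otimes> a \<oplus> s \<otimes> b) (s \<otimes> t)"
      if "(a', s') \<in> ?F a s" "(b', t') \<in> ?F b t" for a' s' b' t'
    proof -
      from that obtain u w where u: "u \<in> S" "u \<otimes> (s' \<otimes> a) = u \<otimes> (s \<otimes> a')"
        and w: "w \<in> S" "w \<otimes> (t' \<otimes> b) = w \<otimes> (t \<otimes> b')"
        and m': "a' \<in> carrier R" "s' \<in> S" "b' \<in> carrier R" "t' \<in> S"
        by (auto simp: memF frac_rel_def)
      note cl = SC[OF u(1)] SC[OF w(1)] SC[OF m(2)] SC[OF m(4)] SC[OF m'(2)] SC[OF m'(4)]
        m(1,3) m'(1,3)
      have "(u \<otimes> w) \<otimes> ((s' \<otimes> t') \<otimes> (t \<otimes> a \<oplus> s \<otimes> b)) =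
          (w \<otimes> t \<otimes> t') \<otimes> (u \<otimes> (s' \<otimes> a)) \<oplus> (u \<otimes> s \<otimes> s') \<otimes> (w \<otimes> (t' \<otimes> b))"
        using cl by (simp add: m_ac r_distr)
      also have "\<dots> = (u \<otimes> w) \<otimes> ((s \<otimes> t) \<otimes> (t' \<otimes> a' \<oplus> s' \<otimes> b'))"
        unfolding u(2) w(2) using cl by (simp add: m_ac r_distr)
      finally show ?thesis
        using m m' u(1) w(1) SM SC by (intro eqI[symmetric]) (auto simp: frac_rel_def)
    qed
    have "?F a s \<oplus>\<^bsub>?Q\<^esub> ?F b t =
        (\<Union>(a', s') \<in> ?F a s. \<Union>(b', t') \<in> ?F b t. ?F (t' \<otimes> a' \<oplus> s' \<otimes> b') (s' \<otimes> t'))"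
      by (simp add: localization_def)
    also have "\<dots> = (\<Union>z \<in> ?F a s. \<Union>z' \<in> ?F b t. ?F (t \<otimes> a \<oplus> s \<otimes> b) (s \<otimes> t))"
      using eq by (intro SUP_cong refl) (auto simp: case_prod_beta)
    also have "\<dots> = ?F (t \<otimes> a \<oplus> s \<otimes> b) (s \<otimes> t)" using self m by blast
    finally show ?thesis .
  qed
  have one: "\<one>\<^bsub>?Q\<^esub> = ?F \<one> \<one>" and zero: "\<zero>\<^bsub>?Q\<^esub> = ?F \<zero> \<one>"
    by (simp_all add: localization_def)
  note simps = mult add one zero SM SC S1
  have FQ: "?F a s \<in> carrier ?Q" if "a \<in> carrier R" "s \<in> S" for a s
    using that carr by auto
  have QF: "\<exists>a s. U = ?F a s \<and> a \<in> carrier R \<and> s \<in> S" if "U \<in> carrier ?Q" for U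
    using that carr by auto
  have "abelian_group ?Q"
  proof (rule abelian_groupI)
    show "\<zero>\<^bsub>?Q\<^esub> \<in> carrier ?Q" using FQ S1 zero by simp
  next
    fix U V assume "U \<in> carrier ?Q" "V \<in> carrier ?Q"
    then show "U \<oplus>\<^bsub>?Q\<^esub> V \<in> carrier ?Q" by (auto dest!: QF simp: simps intro!: FQ)
  next
    fix U V W assume "U \<in> carrier ?Q" "V \<in> carrier ?Q" "W \<in> carrier ?Q"
    then show "(U \<oplus>\<^bsub>?Q\<^esub> V) \<oplus>\<^bsub>?Q\<^esub> W = U \<oplus>\<^bsub>?Q\<^esub> (V \<oplus>\<^bsub>?Q\<^esub> W)"
      by (auto dest!: QF simp: simps r_distr m_ac a_ac intro!: eqI')
  next
    fix U V assume "U \<in> carrier ?Q" "V \<in> carrier ?Q"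
    then show "U \<oplus>\<^bsub>?Q\<^esub> V = V \<oplus>\<^bsub>?Q\<^esub> U"
      by (auto dest!: QF simp: simps m_ac a_ac intro!: eqI')
  next
    fix U assume "U \<in> carrier ?Q"
    then show "\<zero>\<^bsub>?Q\<^esub> \<oplus>\<^bsub>?Q\<^esub> U = U" by (auto dest!: QF simp: simps)
  next
    fix U assume "U \<in> carrier ?Q"
    then obtain a s where U: "U = ?F a s" "a \<in> carrier R" "s \<in> S" using QF by blast
    have "?F (\<ominus> a) s \<oplus>\<^bsub>?Q\<^esub> U = ?F (s \<otimes> (\<ominus> a) \<oplus> s \<otimes> a) (s \<otimes> s)" using U by (simp add: simps)
    also have "s \<otimes> (\<ominus> a) \<oplus> s \<otimes> a = \<zero>" using U SC[OF U(3)] by (simp add: r_minus l_neg)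
    also have "?F \<zero> (s \<otimes> s) = \<zero>\<^bsub>?Q\<^esub>" unfolding zero using U by (intro eqI') (auto simp: SM SC S1)
    finally show "\<exists>V \<in> carrier ?Q. V \<oplus>\<^bsub>?Q\<^esub> U = \<zero>\<^bsub>?Q\<^esub>"
      using U FQ by (intro bexI[of _ "?F (\<ominus> a) s"]) auto
  qed
  moreover have "comm_monoid ?Q"
  proof (rule comm_monoidI)
    show "\<one>\<^bsub>?Q\<^esub> \<in> carrier ?Q" using FQ S1 one by simp
  next
    fix U V assume "U \<in> carrier ?Q" "V \<in> carrier ?Q"
    then show "U \<otimes>\<^bsub>?Q\<^esub> V \<in> carrier ?Q" by (auto dest!: QF simp: simps intro!: FQ)
  next
    fix U V W assume "U \<in> carrier ?Q" "V \<in> carrier ?Q" "W \<in> carrier ?Q"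
    then show "(U \<otimes>\<^bsub>?Q\<^esub> V) \<otimes>\<^bsub>?Q\<^esub> W = U \<otimes>\<^bsub>?Q\<^esub> (V \<otimes>\<^bsub>?Q\<^esub> W)"
      by (auto dest!: QF simp: simps m_ac)
  next
    fix U V assume "U \<in> carrier ?Q" "V \<in> carrier ?Q"
    then show "U \<otimes>\<^bsub>?Q\<^esub> V = V \<otimes>\<^bsub>?Q\<^esub> U" by (auto dest!: QF simp: simps m_ac)
  next
    fix U assume "U \<in> carrier ?Q"
    then show "\<one>\<^bsub>?Q\<^esub> \<otimes>\<^bsub>?Q\<^esub> U = U" by (auto dest!: QF simp: simps)
  qed
  moreover have "(U \<oplus>\<^bsub>?Q\<^esub> V) \<otimes>\<^bsub>?Q\<^esub> W = U \<otimes>\<^bsub>?Q\<^esub> W \<oplus>\<^bsub>?Q\<^esub> V \<otimes>\<^bsub>?Q\<^esub> W"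
    if "U \<in> carrier ?Q" "V \<in> carrier ?Q" "W \<in> carrier ?Q" for U V W
  proof -
    obtain a s b t c r where e: "U = ?F a s" "V = ?F b t" "W = ?F c r"
      and m: "a \<in> carrier R" "s \<in> S" "b \<in> carrier R" "t \<in> S" "c \<in> carrier R" "r \<in> S"
      using \<open>U \<in> carrier ?Q\<close> \<open>V \<in> carrier ?Q\<close> \<open>W \<in> carrier ?Q\<close> QF by metis
    note cl = m(1,3,5) SC[OF m(2)] SC[OF m(4)] SC[OF m(6)]
    have "?F ((t \<otimes> a \<oplus> s \<otimes> b) \<otimes> c) ((s \<otimes> t) \<otimes> r) =
        ?F ((t \<otimes> r) \<otimes> (a \<otimes> c) \<oplus> (s \<otimes> r) \<otimes> (b \<otimes> c)) ((s \<otimes> r) \<otimes> (t \<otimes> r))"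
      using m cl by (intro eqI') (auto simp: SM l_distr r_distr m_ac)
    then show ?thesis using m cl by (simp add: e simps)
  qed
  ultimately show "cring ?Q" by (rule cringI)
qed

definition localization_at :: "('a, 'b) ring_scheme \<Rightarrow> 'a set \<Rightarrow> ('a \<times> 'a) set ring"
  where "localization_at R p = localization R (carrier R - p)"

lemma (in primeideal) submonoid_complement: "submonoid (carrier R - I) R"
  using I_notcarr one_imp_carrier I_prime by unfold_locales auto

definition to_localization_at :: "('a, 'b) ring_scheme \<Rightarrow> 'a set \<Rightarrow> 'a \<Rightarrow> ('a \<times> 'a) set"
  where "to_localization_at R p a = fraction R (carrier R - p) a \<one>\<^bsub>R\<^esub>"

definition symbolic_power :: "('a, 'b) ring_scheme \<Rightarrow> 'a set \<Rightarrow> nat \<Rightarrow> 'a set"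
  where "symbolic_power R p n = {a \<in> carrier R. to_localization_at R p a \<in>
    Idl\<^bsub>localization_at R p\<^esub> (to_localization_at R p ` ideal_power R p n)}"


text \<open>The map \<open>I + a \<mapsto> J + x a\<close> between cosets induced by multiplication by \<open>x\<close>.\<close>

definition induced_mult :: "('a, 'b) ring_scheme \<Rightarrow> 'a \<Rightarrow> 'a set \<Rightarrow> 'a set \<Rightarrow> 'a set"
  where "induced_mult R x J C = J <+>\<^bsub>R\<^esub> ((\<otimes>\<^bsub>R\<^esub>) x ` C)"

lemma (in ring) induced_mult_coset:
  assumes "ideal I R" "ideal J R" "x \<in> carrier R" "a \<in> carrier R"
    and "\<And>b. b \<in> I \<Longrightarrow> x \<otimes> b \<in> J"
  shows "induced_mult R x J (I +> a) = J +> x \<otimes> a"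
proof -
  interpret I: ideal I R by fact
  interpret J: ideal J R by fact
  have "J <+>\<^bsub>R\<^esub> ((\<otimes>) x ` (I +> a)) \<subseteq> J +> x \<otimes> a"
  proof
    fix z assume "z \<in> J <+>\<^bsub>R\<^esub> ((\<otimes>) x ` (I +> a))"
    then obtain j b where z: "j \<in> J" "b \<in> I" "z = j \<oplus> x \<otimes> (b \<oplus> a)"
      by (auto simp: set_add_def set_mult_def a_r_coset_def r_coset_def)
    then have "z = (j \<oplus> x \<otimes> b) \<oplus> x \<otimes> a"
      using assms by (simp add: r_distr a_assoc I.Icarr J.Icarr)
    moreover have "j \<oplus> x \<otimes> b \<in> J" using z assms by simp
    ultimately show "z \<in> J +> x \<otimes> a" by (auto simp: a_r_coset_def r_coset_def)
  qed
  moreover have "J +> x \<otimes> a \<subseteq> J <+>\<^bsub>R\<^esub> ((\<otimes>) x ` (I +> a))"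
  proof -
    have "a \<in> I +> a" using assms by (simp add: I.a_rcos_self)
    then show ?thesis
      by (subst a_r_coset_def) (fastforce simp: set_add_def set_mult_def r_coset_def)
  qed
  ultimately show ?thesis by (simp add: induced_mult_def)
qed

end

theory Submission
  imports Defs
begin

text \<open>Write \<open>S\<close> for the localization at \<open>p\<close>, \<open>n\<close> for its maximal ideal and \<open>s\<close> for its
  index. Everything happens in \<open>S\<close>, a Noetherian local ring of dimension one in which the image
  of \<open>x\<close> is a nonzerodivisor. Since \<open>p\<^sup>(\<^sup>i\<^sup>)\<close> is the contraction of the \<open>i\<close>-th power of \<open>n\<close>, the
  injectivity of multiplication by \<open>x\<close> on the first \<open>s\<close> graded pieces gives, by climbing from
  \<open>i = 0\<close> to \<open>i = s\<close>, that the colon ideal of \<open>n\<^sup>s\<^sup>+\<^sup>t\<close> by \<open>x\<close> lies in \<open>n\<^sup>s\<close>.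

  Among the ideals containing \<open>n\<^sup>s\<^sup>+\<^sup>t\<close> whose colon ideal by \<open>x\<close> still lies in \<open>n\<^sup>s\<close>, choose a
  maximal one, \<open>J\<close>, and put \<open>I = J + x S\<close>. Maximality forces \<open>n\<^sup>s\<^sup>+\<^sup>t\<^sup>-\<^sup>1\<close> into \<open>I\<close>
  (\<open>colon_maximal_ideal\<close>); this is where one power of \<open>n\<close> is gained over the obvious choice
  \<open>J = n\<^sup>s\<^sup>+\<^sup>t\<close>. On the other hand \<open>j + x r \<mapsto> r\<close> is a well-defined surjection from \<open>I\<close> onto
  \<open>S / n\<^sup>s\<close>.

  The ideal \<open>I\<close> contains the nonzerodivisor \<open>x\<close>, so it is a maximal Cohen-Macaulay module
  (\<open>depth_eq_one\<close>). Were it without free direct summand, the surjection would give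
  \<open>\<delta>(S / n\<^sup>s) = 0\<close>, contrary to the choice of \<open>s\<close>. Hence \<open>I\<close> has a free summand, and an ideal
  with a free summand is principal (\<open>free_summand_imp_principal\<close>). Its generator \<open>f\<close> satisfies
  \<open>n\<^sup>s\<^sup>+\<^sup>t\<^sup>-\<^sup>1 \<subseteq> f S\<close>, so it is a parameter that witnesses the bound
  (\<open>gen_loewy_length_le_index\<close>).\<close>

section \<open>Ideals of Noetherian rings\<close>

(* In what follows <+> is the sum of ideals. *)
no_notation Sum_Type.Plus (infixr \<open><+>\<close> 65)

lemma (in noetherian_ring) maximal_ideal_with:
  assumes "ideal I R" "P I"
  obtains M where "ideal M R" "P M" "\<And>J. \<lbrakk>ideal J R; M \<subseteq> J; P J\<rbrakk> \<Longrightarrow> J = M"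
proof -
  define A where "A = {J. ideal J R \<and> P J}"
  have "\<exists>M\<in>A. \<forall>J\<in>A. M \<subseteq> J \<longrightarrow> J = M"
  proof (rule subset_Zorn_nonempty)
    show "A \<noteq> {}" using assms by (auto simp: A_def)
    fix C assume C: "C \<noteq> {}" "subset.chain A C"
    then have "subset.chain {J. ideal J R} C" by (auto simp: A_def pred_on.chain_def)
    then have "\<Union>C \<in> C" using C ideal_chain_is_trivial by blast
    then show "\<Union>C \<in> A" using C by (auto simp: A_def pred_on.chain_def)
  qed
  then show ?thesis using that unfolding A_def by blast
qed

lemma (in cring) add_principal_ideal:
  assumes "ideal J R" "v \<in> carrier R"
  shows "ideal (J <+> PIdl v) R"
    and "J \<subseteq> J <+> PIdl v"
    and "v \<in> J <+> PIdl v"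
    and "\<And>z. z \<in> J <+> PIdl v \<longleftrightarrow> (\<exists>j\<in>J. \<exists>c\<in>carrier R. z = j \<oplus> c \<otimes> v)"
proof -
  interpret J: ideal J R by fact
  show mem: "z \<in> J <+> PIdl v \<longleftrightarrow> (\<exists>j\<in>J. \<exists>c\<in>carrier R. z = j \<oplus> c \<otimes> v)" for z
    by (auto simp: set_add_def' cgenideal_def)
  show "ideal (J <+> PIdl v) R"
    using assms by (intro add_ideals cgenideal_ideal)
  show "J \<subseteq> J <+> PIdl v"
  proof
    fix j assume "j \<in> J"
    then show "j \<in> J <+> PIdl v"
      unfolding mem using assms by (intro bexI[of _ j] bexI[of _ \<zero>]) (auto simp: J.Icarr)
  qed
  show "v \<in> J <+> PIdl v"
    unfolding mem using assms by (intro bexI[of _ \<zero>] bexI[of _ \<one>]) auto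
qed

text \<open>An ideal maximal among those disjoint from a multiplicative set is prime.\<close>

lemma prime_ideal_avoiding:
  fixes R (structure)
  assumes "cring R" "noetherian_ring R" "ideal I R"
    and M: "M \<subseteq> carrier R" "\<one> \<in> M" "\<And>a b. \<lbrakk>a \<in> M; b \<in> M\<rbrakk> \<Longrightarrow> a \<otimes> b \<in> M"
    and disj: "I \<inter> M = {}"
  obtains q where "primeideal q R" "I \<subseteq> q" "q \<inter> M = {}"
proof -
  interpret cring R by fact
  interpret noetherian_ring R by fact
  obtain q where q: "ideal q R" "I \<subseteq> q \<and> q \<inter> M = {}"
    and max: "\<And>J. \<lbrakk>ideal J R; q \<subseteq> J; I \<subseteq> J \<and> J \<inter> M = {}\<rbrakk> \<Longrightarrow> J = q"
    using maximal_ideal_with[OF \<open>ideal I R\<close>, of "\<lambda>J. I \<subseteq> J \<and> J \<inter> M = {}"] disj by blast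
  interpret q: ideal q R by fact
  have hit: "\<exists>j\<in>q. \<exists>c\<in>carrier R. j \<oplus> c \<otimes> a \<in> M" if a: "a \<in> carrier R" "a \<notin> q" for a
  proof (rule ccontr)
    note aq = add_principal_ideal[OF q(1) a(1)]
    assume "\<not> ?thesis"
    then have "(q <+> PIdl a) \<inter> M = {}" using aq(4) by auto
    then have "q <+> PIdl a = q" using aq q by (intro max) auto
    then show False using aq(3) a(2) by blast
  qed
  have "primeideal q R"
  proof (rule primeidealI[OF q(1) is_cring])
    show "carrier R \<noteq> q" using q M(2) by auto
    fix a b assume ab: "a \<in> carrier R" "b \<in> carrier R" "a \<otimes> b \<in> q"
    show "a \<in> q \<or> b \<in> q"
    proof (rule ccontr)
      assume "\<not> ?thesis"
      then obtain i c j d where m: "i \<in> q" "c \<in> carrier R" "i \<oplus> c \<otimes> a \<in> M"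
        "j \<in> q" "d \<in> carrier R" "j \<oplus> d \<otimes> b \<in> M" using hit ab by meson
      have "(i \<oplus> c \<otimes> a) \<otimes> (j \<oplus> d \<otimes> b) =
          i \<otimes> (j \<oplus> d \<otimes> b) \<oplus> (c \<otimes> a \<otimes> j \<oplus> c \<otimes> d \<otimes> (a \<otimes> b))"
        using m ab by (simp add: q.Icarr l_distr r_distr m_ac a_ac)
      also have "\<dots> \<in> q"
        using m ab by (simp add: q.Icarr q.I_r_closed q.I_l_closed)
      finally show False using M(3)[OF m(3,6)] q(2) by auto
    qed
  qed
  then show ?thesis using that q by blast
qed

section \<open>Powers of ideals\<close>

context cring
begin

lemma ideal_power_0: "ideal_power R I 0 = carrier R"
  by (simp add: ideal_power_def nat_pow_def ideals_set_def)

lemma ideal_power_ideal: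
  assumes "ideal I R"
  shows "ideal (ideal_power R I n) R"
proof -
  interpret ideals: comm_monoid "ideals_set R" by (rule ideals_set_is_comm_monoid)
  have "I [^]\<^bsub>ideals_set R\<^esub> n \<in> carrier (ideals_set R)"
    using assms by (intro ideals.nat_pow_closed) (simp add: ideals_set_def)
  then show ?thesis by (simp add: ideal_power_def ideals_set_def)
qed

lemma ideal_power_add:
  assumes "ideal I R"
  shows "ideal_power R I (m + n) = ideal_power R I m \<cdot> ideal_power R I n"
proof -
  interpret ideals: comm_monoid "ideals_set R" by (rule ideals_set_is_comm_monoid)
  have "I [^]\<^bsub>ideals_set R\<^esub> m \<otimes>\<^bsub>ideals_set R\<^esub> I [^]\<^bsub>ideals_set R\<^esub> n = I [^]\<^bsub>ideals_set R\<^esub> (m + n)"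
    using assms by (intro ideals.nat_pow_mult) (simp add: ideals_set_def)
  then show ?thesis by (simp add: ideal_power_def ideals_set_def)
qed

lemma ideal_power_1:
  assumes "ideal I R"
  shows "ideal_power R I 1 = I"
proof -
  interpret ideals: comm_monoid "ideals_set R" by (rule ideals_set_is_comm_monoid)
  have "I [^]\<^bsub>ideals_set R\<^esub> (1::nat) = I"
    using assms by (intro ideals.nat_pow_eone) (simp add: ideals_set_def)
  then show ?thesis by (simp add: ideal_power_def)
qed

lemma ideal_power_mult:
  assumes "ideal I R" "a \<in> ideal_power R I m" "b \<in> ideal_power R I n"
  shows "a \<otimes> b \<in> ideal_power R I (m + n)"
  using assms by (simp add: ideal_power_add ideal_prod.prod)

lemma ideal_power_decreasing:
  assumes "ideal I R" "m \<le> n"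
  shows "ideal_power R I n \<subseteq> ideal_power R I m"
proof -
  obtain k where "n = m + k" using assms le_iff_add by blast
  then show ?thesis
    using assms ideal_prod_inter[OF ideal_power_ideal ideal_power_ideal] by (auto simp: ideal_power_add)
qed

end

section \<open>Noetherian local rings\<close>

lemma noeth_local_ring_max_ideal:
  assumes "noeth_local_ring R"
  shows "maximalideal (max_ideal R) R"
  using assms theI'[of "\<lambda>m. maximalideal m R"] by (simp add: noeth_local_ring_def max_ideal_def)

lemma noeth_local_ring_proper_ideal:
  fixes R (structure)
  assumes loc: "noeth_local_ring R" and I: "ideal I R" "I \<noteq> carrier R"
  shows "I \<subseteq> max_ideal R"
proof -
  interpret noetherian_ring R using loc by (simp add: noeth_local_ring_def)
  obtain m where m: "ideal m R" "I \<subseteq> m \<and> m \<noteq> carrier R"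
    and max: "\<And>J. \<lbrakk>ideal J R; m \<subseteq> J; I \<subseteq> J \<and> J \<noteq> carrier R\<rbrakk> \<Longrightarrow> J = m"
    using maximal_ideal_with[OF I(1), of "\<lambda>J. I \<subseteq> J \<and> J \<noteq> carrier R"] I by blast
  have "maximalideal m R" using m max by (intro maximalidealI) auto
  then have "m = max_ideal R"
    using loc noeth_local_ring_max_ideal[OF loc] by (auto simp: noeth_local_ring_def)
  then show ?thesis using m by simp
qed

lemma noeth_local_ring_unit:
  fixes R (structure)
  assumes loc: "noeth_local_ring R" and a: "a \<in> carrier R" "a \<notin> max_ideal R"
  shows "a \<in> Units R"
proof -
  interpret cring R using loc by (simp add: noeth_local_ring_def)
  have "PIdl a = carrier R"
    using noeth_local_ring_proper_ideal[OF loc cgenideal_ideal] a cgenideal_self by blast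
  then obtain b where "b \<in> carrier R" "\<one> = b \<otimes> a" by (auto simp: cgenideal_def)
  then show ?thesis using a m_comm by (auto simp: Units_def)
qed

lemma prime_chain_le_krull_dim:
  assumes "prime_chain R qs"
  shows "enat (length qs - 1) \<le> krull_dim R"
  unfolding krull_dim_def using assms by (intro SUP_upper) simp

text \<open>Otherwise there would be a prime \<open>q\<close> containing \<open>a\<close> but no power of \<open>b\<close>, hence strictly
  below the maximal ideal. As \<open>a\<close> is a nonzerodivisor, it does not become nilpotent in the
  localization at \<open>q\<close>, which gives a prime inside \<open>q\<close> that misses \<open>a\<close>: a chain of length two.\<close>

lemma power_in_ideal_of_regular_element:
  fixes R (structure)
  assumes loc: "noeth_local_ring R" and dim: "krull_dim R \<le> 1"
    and a: "a \<in> max_ideal R" "\<And>c. \<lbrakk>c \<in> carrier R; a \<otimes> c = \<zero>\<rbrakk> \<Longrightarrow> c = \<zero>"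
    and b: "b \<in> max_ideal R"
  shows "\<exists>k::nat. b [^] k \<in> PIdl a"
proof (rule ccontr)
  assume contr: "\<not> ?thesis"
  interpret cring R using loc by (simp add: noeth_local_ring_def)
  have noeth: "noetherian_ring R" using loc by (simp add: noeth_local_ring_def)
  interpret m: maximalideal "max_ideal R" R by (rule noeth_local_ring_max_ideal[OF loc])
  have carr: "a \<in> carrier R" "b \<in> carrier R" using a b by (auto simp: m.Icarr)
  obtain q where q: "primeideal q R" "PIdl a \<subseteq> q" "q \<inter> {b [^] k | k::nat. True} = {}"
  proof (rule prime_ideal_avoiding[OF is_cring noeth cgenideal_ideal[OF carr(1)],
        of "{b [^] k | k::nat. True}"])
    show "\<one> \<in> {b [^] k | k::nat. True}"
    proof -
      have "\<one> = b [^] (0::nat)" by simp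
      then show ?thesis by blast
    qed
    show "u \<otimes> v \<in> {b [^] k | k::nat. True}"
      if "u \<in> {b [^] k | k::nat. True}" "v \<in> {b [^] k | k::nat. True}" for u v
      using that nat_pow_mult[OF carr(2)] by blast
  qed (use contr carr in auto)
  interpret q: primeideal q R by fact
  have aq: "a \<in> q" using q cgenideal_self[OF carr(1)] by blast
  have "b [^] (1::nat) \<notin> q" using q(3) by blast
  then have bq: "b \<notin> q" using carr by simp
  \<comment> \<open>A prime disjoint from \<open>?M\<close> lies inside \<open>q\<close> (take \<open>k = 0\<close>) and misses \<open>a\<close> (take \<open>u = 1\<close>).\<close>
  let ?M = "{u \<otimes> a [^] k | u k::nat. u \<in> carrier R - q}"
  have one: "\<one> \<notin> q" using q.one_imp_carrier q.I_notcarr by auto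
  obtain r where r: "primeideal r R" "r \<inter> ?M = {}"
  proof (rule prime_ideal_avoiding[OF is_cring noeth zeroideal, of ?M])
    show "?M \<subseteq> carrier R" using carr by auto
    have "\<one> = \<one> \<otimes> a [^] (0::nat)" by simp
    then show "\<one> \<in> ?M" using one by blast
    show "y \<otimes> z \<in> ?M" if yz: "y \<in> ?M" "z \<in> ?M" for y z
    proof -
      obtain u v and k l :: nat where uv: "y = u \<otimes> a [^] k" "z = v \<otimes> a [^] l"
        "u \<in> carrier R - q" "v \<in> carrier R - q" using yz by blast
      have "y \<otimes> z = (u \<otimes> v) \<otimes> (a [^] k \<otimes> a [^] l)" using uv carr by (simp add: m_ac)
      also have "a [^] k \<otimes> a [^] l = a [^] (k + l)" using carr by (simp add: nat_pow_mult)
      finally have "y \<otimes> z = (u \<otimes> v) \<otimes> a [^] (k + l)" .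
      moreover have "u \<otimes> v \<in> carrier R - q" using uv q.I_prime by auto
      ultimately show ?thesis by blast
    qed
    have "u \<otimes> a [^] k = \<zero> \<Longrightarrow> u = \<zero>" if "u \<in> carrier R" for u and k :: nat
    proof (induction k)
      case (Suc k)
      then have "a \<otimes> (u \<otimes> a [^] k) = \<zero>" using that carr by (simp add: m_ac)
      then have "u \<otimes> a [^] k = \<zero>" using that carr by (metis a(2) m_closed nat_pow_closed)
      then show ?case by (rule Suc)
    qed (use that in simp)
    then have "\<zero> \<notin> ?M" using q.additive_subgroup_axioms additive_subgroup.zero_closed
      by (smt (verit) DiffD1 DiffD2 mem_Collect_eq)
    then show "{\<zero>} \<inter> ?M = {}" by blast
  qed
  interpret r: primeideal r R by fact
  have rq: "r \<subseteq> q"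
  proof
    fix u assume u: "u \<in> r"
    have "u = u \<otimes> a [^] (0::nat)" using u r.Icarr by simp
    then show "u \<in> q" using u r r.Icarr by blast
  qed
  have "a \<notin> r"
  proof -
    have "a = \<one> \<otimes> a [^] (1::nat)" using carr by simp
    then have "a \<in> ?M" using one by blast
    then show ?thesis using r by blast
  qed
  then have "r \<subset> q" using rq aq by blast
  moreover have "q \<subset> max_ideal R"
    using noeth_local_ring_proper_ideal[OF loc q.is_ideal] q.I_notcarr b bq by blast
  ultimately have "prime_chain R [r, q, max_ideal R]"
    using q r maximalideal_prime[OF m.is_maximalideal] by (auto simp: prime_chain_def)
  from prime_chain_le_krull_dim[OF this] dim have "enat (Suc (Suc 0)) \<le> 1"
    using order_trans by fastforce
  then show False by (simp add: one_enat_def)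
qed

section \<open>Quotients and scaled submodules\<close>

text \<open>The constructions on modules are typed for records without extension fields, hence the
  restriction of the type of \<open>M\<close>.\<close>

locale plain_module = module R M
  for R :: "('s, 'b) ring_scheme" (structure) and M :: "('s, 'm) module" (structure)
begin

lemma quotient_smult_coset:
  assumes N: "submodule N R M" and a: "a \<in> carrier R" and v: "v \<in> carrier M"
  shows "a \<odot>\<^bsub>quotient_module M N\<^esub> (N +>\<^bsub>M\<^esub> v) = N +>\<^bsub>M\<^esub> (a \<odot>\<^bsub>M\<^esub> v)"
proof -
  note sub = submoduleE[OF N]
  have "\<zero>\<^bsub>M\<^esub> \<in> N" using submodule.axioms(1)[OF N] subgroup.one_closed by fastforce
  have "N <+>\<^bsub>M\<^esub> (smult M a ` (N +>\<^bsub>M\<^esub> v)) = N +>\<^bsub>M\<^esub> (a \<odot>\<^bsub>M\<^esub> v)"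
  proof (intro equalityI subsetI)
    fix z assume "z \<in> N <+>\<^bsub>M\<^esub> (smult M a ` (N +>\<^bsub>M\<^esub> v))"
    then obtain n m where z: "n \<in> N" "m \<in> N" "z = n \<oplus>\<^bsub>M\<^esub> a \<odot>\<^bsub>M\<^esub> (m \<oplus>\<^bsub>M\<^esub> v)"
      by (auto simp: set_add_def' a_r_coset_def')
    then have "n \<in> carrier M" "m \<in> carrier M" using sub(1) by auto
    then have "z = (n \<oplus>\<^bsub>M\<^esub> a \<odot>\<^bsub>M\<^esub> m) \<oplus>\<^bsub>M\<^esub> a \<odot>\<^bsub>M\<^esub> v"
      using z a v by (simp add: smult_r_distr M.a_assoc)
    moreover have "n \<oplus>\<^bsub>M\<^esub> a \<odot>\<^bsub>M\<^esub> m \<in> N" using z a sub by blast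
    ultimately show "z \<in> N +>\<^bsub>M\<^esub> (a \<odot>\<^bsub>M\<^esub> v)" by (auto simp: a_r_coset_def')
  next
    fix z assume "z \<in> N +>\<^bsub>M\<^esub> (a \<odot>\<^bsub>M\<^esub> v)"
    then obtain n where "n \<in> N" "z = n \<oplus>\<^bsub>M\<^esub> a \<odot>\<^bsub>M\<^esub> (\<zero>\<^bsub>M\<^esub> \<oplus>\<^bsub>M\<^esub> v)"
      using v by (auto simp: a_r_coset_def')
    then show "z \<in> N <+>\<^bsub>M\<^esub> (smult M a ` (N +>\<^bsub>M\<^esub> v))"
      using \<open>\<zero>\<^bsub>M\<^esub> \<in> N\<close> unfolding set_add_def' a_r_coset_def' by blast
  qed
  then show ?thesis by (simp add: quotient_module_def)
qed

text \<open>This and the next lemmas reduce regular sequences of length at most two to statements about elements.\<close>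

lemma nonzerodivisor_on_quotient:
  assumes N: "submodule N R M" and a: "a \<in> carrier R"
  shows "nonzerodivisor_on (quotient_module M N) a \<longleftrightarrow>
    (\<forall>v \<in> carrier M. a \<odot>\<^bsub>M\<^esub> v \<in> N \<longrightarrow> v \<in> N)"
proof -
  have sg: "subgroup N (add_monoid M)" by (rule submodule.axioms(1)[OF N])
  have zero: "N +>\<^bsub>M\<^esub> v = N \<longleftrightarrow> v \<in> N" if "v \<in> carrier M" for v
    proof
    show "v \<in> N" if "N +>\<^bsub>M\<^esub> v = N"
      using M.a_coset_join1[OF that \<open>v \<in> carrier M\<close> sg] .
    show "N +>\<^bsub>M\<^esub> v = N" if "v \<in> N"
      using M.a_coset_join2[OF \<open>v \<in> carrier M\<close> sg that] .
  qed
  have carr: "carrier (quotient_module M N) = (\<lambda>v. N +>\<^bsub>M\<^esub> v) ` carrier M"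
    by (auto simp: quotient_module_def A_RCOSETS_def')
  have z: "\<zero>\<^bsub>quotient_module M N\<^esub> = N" by (simp add: quotient_module_def)
  show ?thesis
    unfolding nonzerodivisor_on_def carr z
    using a by (simp add: quotient_smult_coset[OF N a] zero)
qed

lemma zero_submodule: "submodule {\<zero>\<^bsub>M\<^esub>} R M"
  by (rule submoduleI) auto

lemma multiples_submodule:
  assumes a: "a \<in> carrier R"
  shows "submodule ((\<lambda>v. a \<odot>\<^bsub>M\<^esub> v) ` carrier M) R M"
proof (rule submoduleI)
  show "\<zero>\<^bsub>M\<^esub> \<in> (\<lambda>v. a \<odot>\<^bsub>M\<^esub> v) ` carrier M" using a by (intro image_eqI[of _ _ "\<zero>\<^bsub>M\<^esub>"]) auto
  fix u v assume u: "u \<in> (\<lambda>v. a \<odot>\<^bsub>M\<^esub> v) ` carrier M"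
  then obtain u' where u': "u' \<in> carrier M" "u = a \<odot>\<^bsub>M\<^esub> u'" by blast
  then have "\<ominus>\<^bsub>M\<^esub> u = a \<odot>\<^bsub>M\<^esub> (\<ominus>\<^bsub>M\<^esub> u')" using a by (simp add: smult_r_minus)
  then show "\<ominus>\<^bsub>M\<^esub> u \<in> (\<lambda>v. a \<odot>\<^bsub>M\<^esub> v) ` carrier M" using u' by blast
  assume "v \<in> (\<lambda>v. a \<odot>\<^bsub>M\<^esub> v) ` carrier M"
  then obtain v' where v': "v' \<in> carrier M" "v = a \<odot>\<^bsub>M\<^esub> v'" by blast
  then have "u \<oplus>\<^bsub>M\<^esub> v = a \<odot>\<^bsub>M\<^esub> (u' \<oplus>\<^bsub>M\<^esub> v')" using a u' by (simp add: smult_r_distr)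
  then show "u \<oplus>\<^bsub>M\<^esub> v \<in> (\<lambda>v. a \<odot>\<^bsub>M\<^esub> v) ` carrier M" using u' v' by blast
next
  fix c u assume c: "c \<in> carrier R" and "u \<in> (\<lambda>v. a \<odot>\<^bsub>M\<^esub> v) ` carrier M"
  then obtain u' where u': "u' \<in> carrier M" "u = a \<odot>\<^bsub>M\<^esub> u'" by blast
  then have "c \<odot>\<^bsub>M\<^esub> u = a \<odot>\<^bsub>M\<^esub> (c \<odot>\<^bsub>M\<^esub> u')"
    using a c m_comm by (simp flip: smult_assoc1)
  then show "c \<odot>\<^bsub>M\<^esub> u \<in> (\<lambda>v. a \<odot>\<^bsub>M\<^esub> v) ` carrier M" using u' c by blast
qed (use a in auto)

lemma scaled_submodule_empty: "scaled_submodule R M {} = {\<zero>\<^bsub>M\<^esub>}"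
proof -
  have "\<zero>\<^bsub>M\<^esub> \<in> N" if "submodule N R M" for N
    using submodule.axioms(1)[OF that] subgroup.one_closed by fastforce
  then show ?thesis
    using zero_submodule by (auto simp: scaled_submodule_def submodule_span_def)
qed

lemma scaled_submodule_singleton:
  assumes "a \<in> carrier R"
  shows "scaled_submodule R M {a} = (\<lambda>v. a \<odot>\<^bsub>M\<^esub> v) ` carrier M"
  using multiples_submodule[OF assms] unfolding scaled_submodule_def submodule_span_def by blast

lemma scaled_submodule_mono:
  assumes "B \<subseteq> C" "C \<subseteq> carrier R"
  shows "scaled_submodule R M B \<subseteq> scaled_submodule R M C" "scaled_submodule R M C \<subseteq> carrier M"
  using assms carrier_is_submodule unfolding scaled_submodule_def submodule_span_def by blast+

end

text \<open>A module with an injective linear map \<open>g\<close> into the ring, that is, a module isomorphic to the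
  ideal \<open>g ` carrier L\<close>. The module is kept apart from the ideal because the definition of
  \<open>\<delta>\<close> only ranges over modules of one particular type.\<close>

locale embedded_module = plain_module S L
  for S :: "('s, 'b) ring_scheme" (structure) and L :: "('s, 'm) module" (structure) +
  fixes g :: "'m \<Rightarrow> 's"
  assumes hom: "g \<in> module_hom S L (regular_module S)" and inj: "inj_on g (carrier L)"
begin

lemma g_closed [simp]: "v \<in> carrier L \<Longrightarrow> g v \<in> carrier S"
  and g_add: "\<lbrakk>u \<in> carrier L; v \<in> carrier L\<rbrakk> \<Longrightarrow> g (u \<oplus>\<^bsub>L\<^esub> v) = g u \<oplus>\<^bsub>S\<^esub> g v"
  and g_smult: "\<lbrakk>a \<in> carrier S; v \<in> carrier L\<rbrakk> \<Longrightarrow> g (a \<odot>\<^bsub>L\<^esub> v) = a \<otimes>\<^bsub>S\<^esub> g v"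
  using hom by (auto simp: module_hom_def regular_module_def)

lemma g_zero: "g \<zero>\<^bsub>L\<^esub> = \<zero>\<^bsub>S\<^esub>"
proof -
  have "g (\<zero>\<^bsub>S\<^esub> \<odot>\<^bsub>L\<^esub> \<zero>\<^bsub>L\<^esub>) = \<zero>\<^bsub>S\<^esub> \<otimes>\<^bsub>S\<^esub> g \<zero>\<^bsub>L\<^esub>" by (intro g_smult) auto
  then show ?thesis by simp
qed

lemma g_eq_zero: "v \<in> carrier L \<Longrightarrow> g v = \<zero>\<^bsub>S\<^esub> \<longleftrightarrow> v = \<zero>\<^bsub>L\<^esub>"
  using inj g_zero M.zero_closed unfolding inj_on_def by metis

text \<open>Commutativity of the ring, read in \<open>L\<close>; it makes any two elements of \<open>L\<close> linearly dependent.\<close>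

lemma exchange:
  assumes "u \<in> carrier L" "v \<in> carrier L"
  shows "g u \<odot>\<^bsub>L\<^esub> v = g v \<odot>\<^bsub>L\<^esub> u"
  using assms by (intro inj_onD[OF inj]) (auto simp: g_smult R.m_comm)

text \<open>Let \<open>b\<close> be a basis element of the free summand \<open>F\<close>, with complement \<open>N\<close>. For \<open>y\<close> in
  \<open>N\<close> the element \<open>g(y) b = g(b) y\<close> lies in \<open>F \<inter> N = 0\<close>, so \<open>y = 0\<close>; thus \<open>F\<close> is everything.
  For \<open>v\<close> in \<open>F\<close>, comparing the coordinates of \<open>g(v) b = g(b) v\<close> at \<open>b\<close> shows that \<open>g(b)\<close>
  divides \<open>g(v)\<close>.\<close>

lemma free_summand_imp_principal:
  assumes "has_free_summand S L"
  obtains f where "f \<in> g ` carrier L" "g ` carrier L \<subseteq> PIdl\<^bsub>S\<^esub> f"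
proof -
  obtain F N and k :: nat where F: "submodule F S L" and N: "submodule N S L"
    and disj: "F \<inter> N = {\<zero>\<^bsub>L\<^esub>}" and sum: "F <+>\<^bsub>L\<^esub> N = carrier L" and k: "k \<ge> 1"
    and iso: "module_isomorphic S (free_module S k) (L\<lparr>carrier := F\<rparr>)"
    using assms unfolding has_free_summand_def by blast
  obtain h where h: "h \<in> module_hom S (free_module S k) (L\<lparr>carrier := F\<rparr>)"
    "bij_betw h (carrier (free_module S k)) F"
    using iso by (auto simp: module_isomorphic_def)
  note subF = submoduleE[OF F] and subN = submoduleE[OF N]
  have Fr: "carrier (free_module S k) = (\<Pi>\<^sub>E i \<in> {..<k}. carrier S)" by (simp add: free_module_def)
  have hs: "h (\<lambda>i\<in>{..<k}. a \<otimes>\<^bsub>S\<^esub> v i) = a \<odot>\<^bsub>L\<^esub> h v"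
    if "a \<in> carrier S" "v \<in> carrier (free_module S k)" for a v
    using h(1) that by (auto simp: module_hom_def free_module_def)
  have hF: "h v \<in> F" if "v \<in> carrier (free_module S k)" for v
    using h(2) that by (auto simp: bij_betw_def)
  define e where "e = (\<lambda>i\<in>{..<k}. if i = 0 then \<one>\<^bsub>S\<^esub> else \<zero>\<^bsub>S\<^esub>)"
  have e: "e \<in> carrier (free_module S k)" unfolding Fr by (auto simp: e_def)
  define b where "b = h e"
  have b: "b \<in> F" "b \<in> carrier L" using hF[OF e] subF by (auto simp: b_def)
  have inF: "g v \<in> PIdl\<^bsub>S\<^esub> (g b)" if v: "v \<in> F" for v
  proof -
    obtain w where w: "w \<in> carrier (free_module S k)" "v = h w"
      using h(2) v by (auto simp: bij_betw_def)
    have vL: "v \<in> carrier L" using v subF by blast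
    have "h (\<lambda>i\<in>{..<k}. g v \<otimes>\<^bsub>S\<^esub> e i) = h (\<lambda>i\<in>{..<k}. g b \<otimes>\<^bsub>S\<^esub> w i)"
      using hs[OF g_closed[OF vL] e] hs[OF g_closed[OF b(2)] w(1)] exchange[OF vL b(2)]
      by (simp add: w(2) b_def)
    moreover have "(\<lambda>i\<in>{..<k}. c \<otimes>\<^bsub>S\<^esub> u i) \<in> carrier (free_module S k)"
      if "c \<in> carrier S" "u \<in> carrier (free_module S k)" for c u
      using that unfolding Fr by (auto simp: PiE_iff)
    ultimately have "(\<lambda>i\<in>{..<k}. g v \<otimes>\<^bsub>S\<^esub> e i) = (\<lambda>i\<in>{..<k}. g b \<otimes>\<^bsub>S\<^esub> w i)"
      using h(2) vL b e w by (auto simp: bij_betw_def dest!: inj_onD)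
    then have "g v \<otimes>\<^bsub>S\<^esub> e 0 = g b \<otimes>\<^bsub>S\<^esub> w 0"
      using k by (auto dest: fun_cong[of _ _ 0])
    moreover have "w 0 \<in> carrier S" using w k unfolding Fr by (auto simp: PiE_iff)
    ultimately show ?thesis
      using k vL b R.m_comm[of "g b" "w 0"] unfolding cgenideal_def by (auto simp: e_def)
  qed
  have breg: "c = \<zero>\<^bsub>S\<^esub>" if c: "c \<in> carrier S" "c \<odot>\<^bsub>L\<^esub> b = \<zero>\<^bsub>L\<^esub>" for c
  proof -
    have cl: "(\<lambda>i\<in>{..<k}. d \<otimes>\<^bsub>S\<^esub> e i) \<in> carrier (free_module S k)" if "d \<in> carrier S" for d
      using that e unfolding Fr by (auto simp: PiE_iff)
    have "h (\<lambda>i\<in>{..<k}. c \<otimes>\<^bsub>S\<^esub> e i) = h (\<lambda>i\<in>{..<k}. \<zero>\<^bsub>S\<^esub> \<otimes>\<^bsub>S\<^esub> e i)"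
      using hs[OF c(1) e] hs[OF R.zero_closed e] c b by (simp add: b_def)
    then have "(\<lambda>i\<in>{..<k}. c \<otimes>\<^bsub>S\<^esub> e i) = (\<lambda>i\<in>{..<k}. \<zero>\<^bsub>S\<^esub> \<otimes>\<^bsub>S\<^esub> e i)"
      using h(2) cl[OF c(1)] cl[OF R.zero_closed] by (auto simp: bij_betw_def dest!: inj_onD)
    then have "c \<otimes>\<^bsub>S\<^esub> e 0 = \<zero>\<^bsub>S\<^esub> \<otimes>\<^bsub>S\<^esub> e 0" using k by (auto dest: fun_cong[of _ _ 0])
    then show ?thesis using k c by (simp add: e_def)
  qed
  have N0: "y = \<zero>\<^bsub>L\<^esub>" if y: "y \<in> N" for y
  proof -
    have yL: "y \<in> carrier L" using y subN by blast
    have "g y \<odot>\<^bsub>L\<^esub> b \<in> F" using subF(4) yL b by simp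
    moreover have "g y \<odot>\<^bsub>L\<^esub> b \<in> N" using exchange[OF yL b(2)] subN(4) y b by simp
    ultimately have "g y \<odot>\<^bsub>L\<^esub> b = \<zero>\<^bsub>L\<^esub>" using disj by blast
    then have "g y = \<zero>\<^bsub>S\<^esub>" using breg yL by simp
    then show ?thesis using g_eq_zero yL by simp
  qed
  have "carrier L \<subseteq> F"
  proof
    fix v assume "v \<in> carrier L"
    then have "v \<in> F <+>\<^bsub>L\<^esub> N" using sum by simp
    then obtain u y where "u \<in> F" "y \<in> N" "v = u \<oplus>\<^bsub>L\<^esub> y"
      unfolding set_add_def' by blast
    then show "v \<in> F" using N0[of y] subF(1) M.r_zero[of u] by auto
  qed
  then have "g ` carrier L \<subseteq> PIdl\<^bsub>S\<^esub> (g b)" using inF by blast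
  then show ?thesis using that b by blast
qed

text \<open>The element \<open>x\<close> alone is a regular sequence: were \<open>x L\<close> equal to \<open>L\<close>, the preimage of
  \<open>x\<close> would show that 1 lies in the ideal. A regular sequence \<open>a, b\<close> cannot occur, since a power of \<open>b\<close> is
  a multiple of \<open>a\<close>: this power maps \<open>L\<close> into \<open>a L\<close>, so \<open>b\<close> can be a nonzerodivisor on
  \<open>L / a L\<close> only if \<open>L = a L\<close>.\<close>

lemma depth_eq_one:
  assumes loc: "noeth_local_ring S" and dim: "krull_dim S \<le> 1"
    and x: "x \<in> max_ideal S" "\<And>c. \<lbrakk>c \<in> carrier S; x \<otimes>\<^bsub>S\<^esub> c = \<zero>\<^bsub>S\<^esub>\<rbrakk> \<Longrightarrow> c = \<zero>\<^bsub>S\<^esub>"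
    and xL: "x \<in> g ` carrier L" and one: "\<one>\<^bsub>S\<^esub> \<notin> g ` carrier L"
  shows "depth S L = 1"
proof -
  interpret m: maximalideal "max_ideal S" S by (rule noeth_local_ring_max_ideal[OF loc])
  have xS: "x \<in> carrier S" using x m.Icarr by blast
  obtain v where v: "v \<in> carrier L" "g v = x" using xL by blast
  have "v \<notin> scaled_submodule S L {x}"
  proof
    assume "v \<in> scaled_submodule S L {x}"
    then obtain w where w: "w \<in> carrier L" "v = x \<odot>\<^bsub>L\<^esub> w"
      unfolding scaled_submodule_singleton[OF xS] by blast
    then have eq: "x \<otimes>\<^bsub>S\<^esub> (g w \<ominus>\<^bsub>S\<^esub> \<one>\<^bsub>S\<^esub>) = \<zero>\<^bsub>S\<^esub>"
      using v xS g_smult[OF xS w(1)] by (simp add: R.r_distr a_minus_def R.r_minus R.r_neg)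
    have "g w \<ominus>\<^bsub>S\<^esub> \<one>\<^bsub>S\<^esub> = \<zero>\<^bsub>S\<^esub>" by (rule x(2)[OF _ eq]) (use w in simp)
    then have "g w = \<one>\<^bsub>S\<^esub>" using w R.r_right_minus_eq by simp
    then show False using one w(1) by (metis imageI)
  qed
  moreover have "nonzerodivisor_on (quotient_module L {\<zero>\<^bsub>L\<^esub>}) x"
    unfolding nonzerodivisor_on_quotient[OF zero_submodule xS]
  proof (intro ballI impI)
    fix u assume u: "u \<in> carrier L" "x \<odot>\<^bsub>L\<^esub> u \<in> {\<zero>\<^bsub>L\<^esub>}"
    then have "x \<otimes>\<^bsub>S\<^esub> g u = \<zero>\<^bsub>S\<^esub>" using g_smult[OF xS u(1)] g_zero by simp
    then have "g u = \<zero>\<^bsub>S\<^esub>" by (rule x(2)[OF g_closed[OF u(1)]])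
    then show "u \<in> {\<zero>\<^bsub>L\<^esub>}" using g_eq_zero[OF u(1)] by simp
  qed
  ultimately have "regular_sequence S L [x]"
    using v xS by (auto simp: regular_sequence_def scaled_submodule_empty)
  then have "enat (length [x]) \<le> depth S L"
    unfolding depth_def using x by (intro SUP_upper) auto
  moreover have "length ys \<le> 1"
    if ys: "set ys \<subseteq> max_ideal S" "regular_sequence S L ys" for ys
  proof (rule ccontr)
    assume "\<not> ?thesis"
    then obtain a b zs where ab: "ys = a # b # zs"
      by (metis One_nat_def le_numeral_extra(4) length_0_conv length_Cons list.exhaust zero_le)
    then have m: "a \<in> max_ideal S" "b \<in> max_ideal S" and c: "a \<in> carrier S" "b \<in> carrier S"
      using ys m.Icarr by auto
    have reg: "nonzerodivisor_on (quotient_module L (scaled_submodule S L (set (take i ys)))) (ys ! i)"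
      if "i < length ys" for i using ys that unfolding regular_sequence_def by blast
    have a: "u = \<zero>\<^bsub>L\<^esub>" if "u \<in> carrier L" "a \<odot>\<^bsub>L\<^esub> u = \<zero>\<^bsub>L\<^esub>" for u
      using reg[of 0] that nonzerodivisor_on_quotient[OF zero_submodule c(1)]
      by (simp add: ab scaled_submodule_empty)
    have b: "u \<in> scaled_submodule S L {a}"
      if "u \<in> carrier L" "b \<odot>\<^bsub>L\<^esub> u \<in> scaled_submodule S L {a}" for u
      using reg[of 1] that nonzerodivisor_on_quotient[OF multiples_submodule[OF c(1)] c(2)]
      by (simp add: ab scaled_submodule_singleton c)
    have "\<exists>k::nat. b [^]\<^bsub>S\<^esub> k \<in> PIdl\<^bsub>S\<^esub> a"
    proof (rule power_in_ideal_of_regular_element[OF loc dim m(1) _ m(2)])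
      fix d assume d: "d \<in> carrier S" "a \<otimes>\<^bsub>S\<^esub> d = \<zero>\<^bsub>S\<^esub>"
      then have "a \<odot>\<^bsub>L\<^esub> (d \<odot>\<^bsub>L\<^esub> v) = \<zero>\<^bsub>L\<^esub>" using c v by (simp flip: smult_assoc1)
      then have "d \<odot>\<^bsub>L\<^esub> v = \<zero>\<^bsub>L\<^esub>" by (rule a[rotated]) (use d v in simp)
      then have "x \<otimes>\<^bsub>S\<^esub> d = \<zero>\<^bsub>S\<^esub>" using g_smult[OF d(1) v(1)] g_zero v d xS by (simp add: R.m_comm)
      then show "d = \<zero>\<^bsub>S\<^esub>" using x(2) d by blast
    qed
    then obtain k :: nat and d where k: "d \<in> carrier S" "b [^]\<^bsub>S\<^esub> k = d \<otimes>\<^bsub>S\<^esub> a"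
      by (auto simp: cgenideal_def)
    have step: "b [^]\<^bsub>S\<^esub> j \<odot>\<^bsub>L\<^esub> u \<in> scaled_submodule S L {a} \<Longrightarrow> u \<in> scaled_submodule S L {a}"
      if u: "u \<in> carrier L" for u and j :: nat
    proof (induction j)
      case (Suc j)
      have cl: "b [^]\<^bsub>S\<^esub> j \<odot>\<^bsub>L\<^esub> u \<in> carrier L" using u c by simp
      have "b [^]\<^bsub>S\<^esub> Suc j \<odot>\<^bsub>L\<^esub> u = b \<odot>\<^bsub>L\<^esub> (b [^]\<^bsub>S\<^esub> j \<odot>\<^bsub>L\<^esub> u)"
        using u c by (simp add: R.m_comm flip: smult_assoc1)
      then have "b [^]\<^bsub>S\<^esub> j \<odot>\<^bsub>L\<^esub> u \<in> scaled_submodule S L {a}"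
        using Suc.prems b[OF cl] by argo
      then show ?case by (rule Suc.IH)
    qed (use u in simp)
    have "carrier L \<subseteq> scaled_submodule S L {a}"
    proof
      fix u assume u: "u \<in> carrier L"
      have "b [^]\<^bsub>S\<^esub> k \<odot>\<^bsub>L\<^esub> u = a \<odot>\<^bsub>L\<^esub> (d \<odot>\<^bsub>L\<^esub> u)"
        using k u c by (simp add: R.m_comm flip: smult_assoc1)
      then have "b [^]\<^bsub>S\<^esub> k \<odot>\<^bsub>L\<^esub> u \<in> scaled_submodule S L {a}"
        using u k c by (simp add: scaled_submodule_singleton)
      then show "u \<in> scaled_submodule S L {a}" by (rule step[OF u])
    qed
    also have "\<dots> \<subseteq> scaled_submodule S L (set ys)"
      using ys m.Icarr by (intro scaled_submodule_mono) (auto simp: ab)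
    finally have "scaled_submodule S L (set ys) = carrier L"
      using ys m.Icarr scaled_submodule_mono(2)[of "{}" "set ys"] by blast
    then show False using ys by (simp add: regular_sequence_def)
  qed
  then have "depth S L \<le> 1"
    unfolding depth_def one_enat_def by (intro SUP_least) auto
  ultimately show ?thesis by (simp add: one_enat_def)
qed

end

section \<open>Ideals as finitely generated modules\<close>

lemma regular_module_simps [simp]:
  "carrier (regular_module S) = carrier S"
  "u \<oplus>\<^bsub>regular_module S\<^esub> v = u \<oplus>\<^bsub>S\<^esub> v"
  "a \<odot>\<^bsub>regular_module S\<^esub> v = a \<otimes>\<^bsub>S\<^esub> v"
  "\<zero>\<^bsub>regular_module S\<^esub> = \<zero>\<^bsub>S\<^esub>"
  by (simp_all add: regular_module_def)

lemma regular_module_is_module: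
  fixes S (structure)
  assumes "cring S"
  shows "module S (regular_module S)"
proof -
  interpret cring S by fact
  have "abelian_group (regular_module S)"
    by (rule abelian_groupI) (auto simp: regular_module_def a_ac intro: l_neg)
  then show ?thesis
    by (intro moduleI is_cring) (auto simp: regular_module_def l_distr r_distr m_assoc)
qed

lemma ideal_is_module:
  fixes S (structure)
  assumes "cring S" "ideal I S"
  shows "module S ((regular_module S)\<lparr>carrier := I\<rparr>)"
proof -
  interpret cring S by fact
  interpret I: ideal I S by fact
  interpret reg: module S "regular_module S" by (rule regular_module_is_module[OF is_cring])
  have "\<ominus>\<^bsub>regular_module S\<^esub> a = \<ominus> a" for a
    by (simp add: regular_module_def a_inv_def m_inv_def)
  then have "submodule I S (regular_module S)"
    by (intro reg.submoduleI) (auto simp: regular_module_def I.I_l_closed I.Icarr)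
  then show ?thesis
    by (rule submodule.submodule_is_module) (rule reg.module_axioms)
qed

text \<open>The linear combinations of a finite generating set form an ideal, which therefore is all of
  \<open>I\<close>.\<close>

lemma ideal_fin_gen_module:
  fixes S (structure)
  assumes "cring S" "noetherian_ring S" and I: "ideal I S"
  shows "fin_gen_module S ((regular_module S)\<lparr>carrier := I\<rparr>)"
proof -
  let ?M = "(regular_module S)\<lparr>carrier := I\<rparr>"
  interpret cring S by fact
  interpret noetherian_ring S by fact
  interpret I: ideal I S by fact
  interpret M: module S ?M by (rule ideal_is_module[OF is_cring I])
  have M: "carrier ?M = I" by simp
  obtain A where A: "A \<subseteq> carrier S" "finite A" "I = Idl A" using finetely_gen[OF I] by blast
  have AI: "A \<subseteq> I" using A genideal_self by blast
  define C where "C = {\<Oplus>\<^bsub>?M\<^esub> u \<in> A. c u \<odot>\<^bsub>?M\<^esub> u | c. c \<in> A \<rightarrow> carrier S}"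
  have cl: "(\<lambda>u. c u \<odot>\<^bsub>?M\<^esub> u) \<in> A \<rightarrow> carrier ?M" if "c \<in> A \<rightarrow> carrier S" for c
    using that AI I.I_l_closed by (auto simp: Pi_iff subset_iff)
  have CI: "C \<subseteq> I" using M.M.finsum_closed[OF cl] unfolding C_def by auto
  have Csmult: "a \<otimes> u \<in> C" if a: "a \<in> carrier S" and "u \<in> C" for a u
  proof -
    obtain c where c: "c \<in> A \<rightarrow> carrier S" "u = (\<Oplus>\<^bsub>?M\<^esub> u \<in> A. c u \<odot>\<^bsub>?M\<^esub> u)"
      using \<open>u \<in> C\<close> by (auto simp: C_def)
    have "a \<otimes> u = (\<Oplus>\<^bsub>?M\<^esub> u \<in> A. a \<odot>\<^bsub>?M\<^esub> (c u \<odot>\<^bsub>?M\<^esub> u))"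
      using M.finsum_smult_ldistr[OF A(2) a cl[OF c(1)]] c(2) by simp
    also have "\<dots> = (\<Oplus>\<^bsub>?M\<^esub> u \<in> A. (a \<otimes> c u) \<odot>\<^bsub>?M\<^esub> u)"
      using a c AI I.Icarr by (intro M.M.add.finprod_cong') (auto simp: m_assoc I.I_l_closed Pi_iff subset_iff)
    finally show ?thesis
      using a c unfolding C_def by (intro CollectI exI[of _ "\<lambda>u. a \<otimes> c u"]) auto
  qed
  have Cadd: "u \<oplus> v \<in> C" if uv: "u \<in> C" "v \<in> C" for u v
  proof -
    obtain c d where c: "c \<in> A \<rightarrow> carrier S" "u = (\<Oplus>\<^bsub>?M\<^esub> u \<in> A. c u \<odot>\<^bsub>?M\<^esub> u)"
      and d: "d \<in> A \<rightarrow> carrier S" "v = (\<Oplus>\<^bsub>?M\<^esub> u \<in> A. d u \<odot>\<^bsub>?M\<^esub> u)"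
      using uv unfolding C_def by blast
    have "u \<oplus> v = (\<Oplus>\<^bsub>?M\<^esub> u \<in> A. c u \<odot>\<^bsub>?M\<^esub> u \<oplus>\<^bsub>?M\<^esub> d u \<odot>\<^bsub>?M\<^esub> u)"
      using M.M.finsum_addf[OF cl[OF c(1)] cl[OF d(1)]] c(2) d(2) by simp
    also have "\<dots> = (\<Oplus>\<^bsub>?M\<^esub> u \<in> A. (c u \<oplus> d u) \<odot>\<^bsub>?M\<^esub> u)"
      using c d AI I.Icarr by (intro M.M.add.finprod_cong') (auto simp: l_distr I.I_l_closed Pi_iff subset_iff)
    finally show ?thesis
      using c d unfolding C_def by (intro CollectI exI[of _ "\<lambda>u. c u \<oplus> d u"]) auto
  qed
  have AC: "A \<subseteq> C"
  proof
    fix a assume a: "a \<in> A"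
    have "(\<Oplus>\<^bsub>?M\<^esub> u \<in> A. (if a = u then \<one> else \<zero>) \<odot>\<^bsub>?M\<^esub> u) = (\<Oplus>\<^bsub>?M\<^esub> u \<in> A. if a = u then u else \<zero>\<^bsub>?M\<^esub>)"
      using AI I.Icarr by (intro M.M.add.finprod_cong') auto
    also have "\<dots> = a"
      using M.M.add.finprod_singleton[OF a A(2), of "\<lambda>u. u"] AI by auto
    finally show "a \<in> C" unfolding C_def by (auto intro!: exI[of _ "\<lambda>u. if a = u then \<one> else \<zero>"])
  qed
  have zero: "\<zero> \<in> C"
  proof -
    have "(\<Oplus>\<^bsub>?M\<^esub> u \<in> A. \<zero> \<odot>\<^bsub>?M\<^esub> u) = (\<Oplus>\<^bsub>?M\<^esub> u \<in> A. \<zero>\<^bsub>?M\<^esub>)"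
      using AI I.Icarr by (intro M.M.add.finprod_cong') auto
    then have "(\<Oplus>\<^bsub>?M\<^esub> u \<in> A. \<zero> \<odot>\<^bsub>?M\<^esub> u) = \<zero>" using M.M.finsum_zero by simp
    then show ?thesis unfolding C_def by (intro CollectI exI[of _ "\<lambda>_. \<zero>"]) auto
  qed
  have "ideal C S"
  proof (intro idealI subgroup.intro)
    show "C \<subseteq> carrier (add_monoid S)" using CI I.Icarr by auto
    show "inv\<^bsub>add_monoid S\<^esub> u \<in> C" if "u \<in> C" for u
    proof -
      have "u \<in> carrier S" using that CI I.Icarr by blast
      then have "\<ominus> u = (\<ominus> \<one>) \<otimes> u" by (simp add: l_minus)
      also have "\<dots> \<in> C" using that by (intro Csmult) auto
      finally show ?thesis by (simp only: a_inv_def)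
    qed
    show "u \<otimes> a \<in> C" if "u \<in> C" "a \<in> carrier S" for u a
    proof -
      have "u \<in> carrier S" using that CI I.Icarr by blast
      then show ?thesis using Csmult that m_comm by simp
    qed
  qed (use Csmult Cadd zero ring_axioms in auto)
  then have "I \<subseteq> C" using A(3) genideal_minimal AC by blast
  then show ?thesis
    using M.module_axioms A(2) AI unfolding fin_gen_module_def C_def M by blast
qed

text \<open>Moves an ideal to the type of modules over which the definition of \<open>\<delta>\<close> quantifies.\<close>

lemma ideal_representative:
  fixes S :: "('s, 'b) ring_scheme" (structure)
  assumes "cring S" "noetherian_ring S" "ideal I S"
  obtains L :: "('s, (nat \<Rightarrow> 's) set) module" and g
  where "fin_gen_module S L" "embedded_module S L g" "g ` carrier L = I"
proof -
  let ?M = "(regular_module S)\<lparr>carrier := I\<rparr>"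
  interpret cring S by fact
  interpret I: ideal I S by fact
  interpret M: module S ?M by (rule ideal_is_module[OF is_cring \<open>ideal I S\<close>])
  obtain L :: "('s, (nat \<Rightarrow> 's) set) module" and h where L: "fin_gen_module S L"
    and h: "h \<in> module_hom S ?M L" "bij_betw h I (carrier L)"
    using fin_gen_module_representative[OF ideal_fin_gen_module[OF assms]]
    by (auto simp: module_isomorphic_def)
  interpret L: module S L using L by (simp add: fin_gen_module_def)
  define g where "g = inv_into I h"
  have gb: "bij_betw g (carrier L) I" unfolding g_def by (rule bij_betw_inv_into[OF h(2)])
  have hg: "h (g v) = v" if "v \<in> carrier L" for v
    using that h(2) by (simp add: g_def bij_betw_inv_into_right)
  have gh: "g (h v) = v" if "v \<in> I" for v
    using that h(2) by (simp add: g_def bij_betw_inv_into_left)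
  have gI: "g v \<in> I" if "v \<in> carrier L" for v using gb that by (auto simp: bij_betw_def)
  have hom: "h (u \<oplus> v) = h u \<oplus>\<^bsub>L\<^esub> h v" "h (a \<otimes> v) = a \<odot>\<^bsub>L\<^esub> h v"
    if "u \<in> I" "v \<in> I" "a \<in> carrier S" for u v a
    using h(1) that by (auto simp: module_hom_def regular_module_def)
  have "g \<in> module_hom S L (regular_module S)"
  proof -
    have "g (u \<oplus>\<^bsub>L\<^esub> v) = g u \<oplus> g v" if "u \<in> carrier L" "v \<in> carrier L" for u v
      using that hom(1)[of "g u" "g v" "\<zero>"] gh[of "g u \<oplus> g v"] by (simp add: hg gI)
    moreover have "g (a \<odot>\<^bsub>L\<^esub> v) = a \<otimes> g v" if "v \<in> carrier L" "a \<in> carrier S" for a v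
      using that hom(2)[of "g v" "g v" a] gh[of "a \<otimes> g v"] by (simp add: hg gI I.I_l_closed)
    ultimately show ?thesis
      using gI I.Icarr by (auto simp: module_hom_def regular_module_def)
  qed
  then have "embedded_module S L g"
    using gb L.module_axioms
    by (simp add: embedded_module_def embedded_module_axioms_def plain_module_def bij_betw_def)
  then show ?thesis using that L gb by (simp add: bij_betw_def)
qed

section \<open>The index and the generalized Loewy length\<close>

lemma auslander_delta_eq_0:
  fixes S :: "('s, 'b) ring_scheme" (structure) and L :: "('s, (nat \<Rightarrow> 's) set) module"
  assumes "max_cohen_macaulay S L" "\<not> has_free_summand S L"
    and f: "f \<in> module_hom S L M" "f ` carrier L = carrier M"
  shows "auslander_delta S M = 0"
proof -
  let ?D = "direct_sum L (free_module S 0)"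
  have "f \<circ> fst \<in> module_hom S ?D M"
    using f(1) by (auto simp: module_hom_def direct_sum_def)
  moreover have "(f \<circ> fst) ` carrier ?D = carrier M"
    using f(2) by (force simp: direct_sum_def free_module_def image_image)
  ultimately have "auslander_delta S M \<le> enat 0"
    unfolding auslander_delta_def using assms by (intro Inf_lower imageI) blast
  then show ?thesis by (simp add: zero_enat_def[symmetric])
qed

lemma auslander_index_enatD:
  assumes "auslander_index S = enat s"
  shows "1 \<le> s"
    and "auslander_delta S (quotient_module (regular_module S) (ideal_power S (max_ideal S) s)) = 1"
proof -
  define A where "A = enat ` {n. 1 \<le> n \<and>
    auslander_delta S (quotient_module (regular_module S) (ideal_power S (max_ideal S) n)) = 1}"
  have "Inf A = enat s" using assms by (simp add: A_def auslander_index_def)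
  then have "enat s \<in> A" unfolding Inf_enat_def by (metis LeastI enat.distinct(1) ex_in_conv)
  then show "1 \<le> s" "auslander_delta S (quotient_module (regular_module S) (ideal_power S (max_ideal S) s)) = 1"
    by (auto simp: A_def)
qed

text \<open>Take \<open>J\<close> maximal among the ideals above the power with exponent \<open>k + 1\<close> whose colon ideal
  by \<open>x\<close> lies in \<open>K\<close>. If \<open>v\<close> lies in the \<open>k\<close>-th power but not in \<open>J\<close>, maximality yields
  \<open>x r = j + c v\<close> with \<open>r\<close> outside \<open>K\<close>. The coefficient \<open>c\<close> must be a unit, as otherwise
  \<open>c v\<close> lies in the power with exponent \<open>k + 1\<close> and \<open>x r\<close> in \<open>J\<close>. Solving for \<open>v\<close> puts it
  into \<open>J + x S\<close>.\<close>

lemma colon_maximal_ideal: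
  fixes S (structure)
  assumes loc: "noeth_local_ring S" and x: "x \<in> carrier S"
    and colon: "\<And>r. \<lbrakk>r \<in> carrier S; x \<otimes> r \<in> ideal_power S (max_ideal S) (Suc k)\<rbrakk> \<Longrightarrow> r \<in> K"
  obtains J where "ideal J S"
    and "\<And>r. \<lbrakk>r \<in> carrier S; x \<otimes> r \<in> J\<rbrakk> \<Longrightarrow> r \<in> K"
    and "ideal_power S (max_ideal S) k \<subseteq> J <+> PIdl x"
proof -
  interpret cring S using loc by (simp add: noeth_local_ring_def)
  interpret noetherian_ring S using loc by (simp add: noeth_local_ring_def)
  interpret m: maximalideal "max_ideal S" S by (rule noeth_local_ring_max_ideal[OF loc])
  let ?n = "ideal_power S (max_ideal S)"
  have n: "ideal (?n i) S" for i by (rule ideal_power_ideal[OF m.is_ideal])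
  define P where "P J \<longleftrightarrow> ?n (Suc k) \<subseteq> J \<and> (\<forall>r\<in>carrier S. x \<otimes> r \<in> J \<longrightarrow> r \<in> K)" for J
  have "P (?n (Suc k))" using colon by (auto simp: P_def)
  then obtain J where J: "ideal J S" "P J"
    and max: "\<And>J'. \<lbrakk>ideal J' S; J \<subseteq> J'; P J'\<rbrakk> \<Longrightarrow> J' = J"
    using maximal_ideal_with[OF n[of "Suc k"], of P] by blast
  interpret J: ideal J S by fact
  have JP: "?n (Suc k) \<subseteq> J" "\<And>r. \<lbrakk>r \<in> carrier S; x \<otimes> r \<in> J\<rbrakk> \<Longrightarrow> r \<in> K"
    using J(2) by (auto simp: P_def)
  note Jx = add_principal_ideal[OF J(1) x]
  have "v \<in> J <+> PIdl x" if v: "v \<in> ?n k" for v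
  proof (cases "v \<in> J")
    case True
    then show ?thesis using Jx(2) by blast
  next
    case False
    have vS: "v \<in> carrier S" using v n ideal.Icarr by metis
    note Jv = add_principal_ideal[OF J(1) vS]
    have "\<not> P (J <+> PIdl v)" using max[OF Jv(1,2)] Jv(3) False by auto
    then obtain r where r: "r \<in> carrier S" "x \<otimes> r \<in> J <+> PIdl v" "r \<notin> K"
      using JP(1) Jv(2) unfolding P_def by blast
    then obtain j c where jc: "j \<in> J" "c \<in> carrier S" "x \<otimes> r = j \<oplus> c \<otimes> v"
      using Jv(4) by blast
    have "c \<notin> max_ideal S"
    proof
      assume c: "c \<in> max_ideal S"
      have "c \<otimes> v \<in> ?n (1 + k)"
        using v c by (intro ideal_power_mult[OF m.is_ideal]) (simp only: ideal_power_1[OF m.is_ideal])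
      then have "c \<otimes> v \<in> J" using JP(1) by auto
      then have "x \<otimes> r \<in> J" using jc by simp
      then show False using JP(2) r by blast
    qed
    then have u: "c \<in> Units S" using noeth_local_ring_unit[OF loc jc(2)] by blast
    have jS: "j \<in> carrier S" and ic: "inv c \<in> carrier S" using jc u J.Icarr by auto
    have "\<ominus> (inv c \<otimes> j) \<oplus> inv c \<otimes> r \<otimes> x = inv c \<otimes> (\<ominus> j \<oplus> x \<otimes> r)"
      using jS ic r x by (simp add: r_distr r_minus m_ac)
    also have "\<ominus> j \<oplus> x \<otimes> r = c \<otimes> v" using jc jS vS by (simp add: r_neg1)
    also have "inv c \<otimes> (c \<otimes> v) = v" using u vS jc ic by (simp flip: m_assoc)
    finally have "v = \<ominus> (inv c \<otimes> j) \<oplus> inv c \<otimes> r \<otimes> x" ..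
    moreover have "\<ominus> (inv c \<otimes> j) \<in> J" using jc ic by (simp add: J.I_l_closed)
    ultimately show ?thesis using Jx(4) r ic by blast
  qed
  then show ?thesis using that[OF J(1) JP(2)] by blast
qed

text \<open>The form of the result for a one-dimensional local ring: the ideal \<open>J + x S\<close> with \<open>J\<close>
  from the previous lemma is principal, because otherwise it would be a maximal Cohen-Macaulay
  module without free summand mapping onto the quotient by the \<open>s\<close>-th power of the maximal ideal.\<close>

theorem gen_loewy_length_le_index:
  fixes S :: "('s, 'b) ring_scheme" (structure)
  assumes loc: "noeth_local_ring S" and dim: "krull_dim S = 1"
    and index: "auslander_index S = enat s" and t: "t \<ge> 1"
    and x: "x \<in> max_ideal S" "\<And>c. \<lbrakk>c \<in> carrier S; x \<otimes> c = \<zero>\<rbrakk> \<Longrightarrow> c = \<zero>"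
    and colon: "\<And>r. \<lbrakk>r \<in> carrier S; x \<otimes> r \<in> ideal_power S (max_ideal S) (s + t)\<rbrakk>
      \<Longrightarrow> r \<in> ideal_power S (max_ideal S) s"
  shows "gen_loewy_length S \<le> enat (s + t - 1)"
proof -
  interpret cring S using loc by (simp add: noeth_local_ring_def)
  have noeth: "noetherian_ring S" using loc by (simp add: noeth_local_ring_def)
  interpret m: maximalideal "max_ideal S" S by (rule noeth_local_ring_max_ideal[OF loc])
  let ?n = "ideal_power S (max_ideal S)"
  interpret n: ideal "?n s" S by (rule ideal_power_ideal[OF m.is_ideal])
  have xS: "x \<in> carrier S" using x m.Icarr by blast
  note s = auslander_index_enatD[OF index]
  have st: "Suc (s + t - 1) = s + t" using t by simp
  obtain J where J: "ideal J S" "\<And>r. \<lbrakk>r \<in> carrier S; x \<otimes> r \<in> J\<rbrakk> \<Longrightarrow> r \<in> ?n s"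
    and sub: "?n (s + t - 1) \<subseteq> J <+> PIdl x"
    using colon_maximal_ideal[OF loc xS, of "s + t - 1" "?n s"] colon unfolding st by blast
  interpret J: ideal J S by fact
  define I where "I = J <+> PIdl x"
  have I: "ideal I S" "x \<in> I" "\<And>z. z \<in> I \<longleftrightarrow> (\<exists>j\<in>J. \<exists>c\<in>carrier S. z = j \<oplus> c \<otimes> x)"
    unfolding I_def by (rule add_principal_ideal[OF J(1) xS])+
  interpret I: ideal I S by fact
  have "?n s \<subseteq> max_ideal S"
    using ideal_power_decreasing[OF m.is_ideal s(1)] by (simp only: ideal_power_1[OF m.is_ideal])
  then have "\<one> \<notin> ?n s" using m.one_imp_carrier m.I_notcarr by blast
  then have "J \<noteq> carrier S" using J(2)[of "\<one>"] xS by auto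
  then have Jm: "J \<subseteq> max_ideal S" by (rule noeth_local_ring_proper_ideal[OF loc J(1)])
  have Im: "I \<subseteq> max_ideal S"
  proof
    fix z assume "z \<in> I"
    then show "z \<in> max_ideal S" using Jm x I(3) m.I_l_closed by auto
  qed
  then have one: "\<one> \<notin> I" using m.one_imp_carrier m.I_notcarr by blast
  obtain L :: "('s, (nat \<Rightarrow> 's) set) module" and g where fg: "fin_gen_module S L"
    and emb: "embedded_module S L g" and gI: "g ` carrier L = I"
    by (rule ideal_representative[OF is_cring noeth I(1)])
  interpret L: embedded_module S L g by fact
  have "depth S L = 1"
    by (rule L.depth_eq_one[OF loc _ x]) (use dim gI I(2) one in simp_all)
  then have mcm: "max_cohen_macaulay S L" using fg dim by (simp add: max_cohen_macaulay_def)
  have "has_free_summand S L"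
  proof (rule ccontr)
    assume nofree: "\<not> has_free_summand S L"
    let ?Q = "quotient_module (regular_module S) (?n s)"
    \<comment> \<open>The coefficient of \<open>x\<close> is determined modulo \<open>?n s\<close>: this is where the colon ideal of \<open>J\<close> matters.\<close>
    have cos: "c \<ominus> d \<in> ?n s"
      if "j \<in> J" "k \<in> J" "c \<in> carrier S" "d \<in> carrier S" "j \<oplus> c \<otimes> x = k \<oplus> d \<otimes> x" for j k c d
    proof -
      have jk: "j \<in> carrier S" "k \<in> carrier S" using that J.Icarr by auto
      have "x \<otimes> (c \<ominus> d) = c \<otimes> x \<ominus> d \<otimes> x"
        using that xS by (simp add: r_distr r_minus a_minus_def m_comm)
      also have "c \<otimes> x = \<ominus> j \<oplus> (k \<oplus> d \<otimes> x)"
        using that(3) jk xS by (simp add: r_neg1 flip: that(5))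
      also have "\<ominus> j \<oplus> (k \<oplus> d \<otimes> x) \<ominus> d \<otimes> x = \<ominus> j \<oplus> k"
        using that(4) jk xS by (simp add: a_minus_def a_assoc r_neg)
      finally have "x \<otimes> (c \<ominus> d) \<in> J" using that by (simp add: a_minus_def)
      then show ?thesis using J(2) that by simp
    qed
    \<comment> \<open>Some coefficient of \<open>x\<close> in a representation of \<open>z\<close>.\<close>
    define \<phi> where "\<phi> z = (SOME c. c \<in> carrier S \<and> (\<exists>j\<in>J. z = j \<oplus> c \<otimes> x))" for z
    have \<phi>: "\<phi> z \<in> carrier S" "\<exists>j\<in>J. z = j \<oplus> \<phi> z \<otimes> x" if "z \<in> I" for z
      using someI_ex[of "\<lambda>c. c \<in> carrier S \<and> (\<exists>j\<in>J. z = j \<oplus> c \<otimes> x)"] that I(3)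
      unfolding \<phi>_def by blast+
    have coset: "?n s +> \<phi> z = ?n s +> c"
      if "j \<in> J" "c \<in> carrier S" "z = j \<oplus> c \<otimes> x" for z j c
    proof -
      have "z \<in> I" using that I(3) by blast
      then obtain k where k: "k \<in> J" "z = k \<oplus> \<phi> z \<otimes> x" "\<phi> z \<in> carrier S" using \<phi> by blast
      then have "\<phi> z \<ominus> c \<in> ?n s" using that by (intro cos[of k j]) auto
      then show ?thesis
        using quotient_eq_iff_same_a_r_cos[OF n.is_ideal k(3) that(2)] by simp
    qed
    interpret reg: plain_module S "regular_module S"
      unfolding plain_module_def by (rule regular_module_is_module[OF is_cring])
    have cQ: "(+>\<^bsub>regular_module S\<^esub>) = (+>)" "(<+>\<^bsub>regular_module S\<^esub>) = (<+>)"
      "a_rcosets\<^bsub>regular_module S\<^esub> (?n s) = a_rcosets (?n s)"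
      "carrier (regular_module S) = carrier S" "(\<odot>\<^bsub>regular_module S\<^esub>) = (\<otimes>)"
      by (auto simp: regular_module_def fun_eq_iff a_r_coset_def' set_add_def' A_RCOSETS_def')
    have neg: "\<ominus>\<^bsub>regular_module S\<^esub> a = \<ominus> a" for a
      by (simp add: regular_module_def a_inv_def m_inv_def)
    have "submodule (?n s) S (regular_module S)"
      by (rule reg.submoduleI) (auto simp: neg, auto simp: regular_module_def n.I_l_closed n.Icarr)
    note smult = reg.quotient_smult_coset[OF this, unfolded cQ]
    define f where "f v = ?n s +> \<phi> (g v)" for v
    have gv: "\<exists>j\<in>J. \<exists>c\<in>carrier S. g v = j \<oplus> c \<otimes> x" if "v \<in> carrier L" for v
      using that gI I(3) by blast
    have "f \<in> module_hom S L ?Q"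
    proof -
      have "f u \<in> carrier ?Q" if "u \<in> carrier L" for u
        using \<phi>(1)[of "g u"] that gI n.a_subset by (auto simp: f_def quotient_module_def cQ intro!: a_rcosetsI)
      moreover have "f (u \<oplus>\<^bsub>L\<^esub> v) = f u \<oplus>\<^bsub>?Q\<^esub> f v" if uv: "u \<in> carrier L" "v \<in> carrier L" for u v
      proof -
        obtain j c k d where e: "j \<in> J" "c \<in> carrier S" "g u = j \<oplus> c \<otimes> x"
          "k \<in> J" "d \<in> carrier S" "g v = k \<oplus> d \<otimes> x" using gv uv by metis
        then have "j \<in> carrier S" "k \<in> carrier S" using J.Icarr by auto
        then have "g (u \<oplus>\<^bsub>L\<^esub> v) = (j \<oplus> k) \<oplus> (c \<oplus> d) \<otimes> x"
          using L.g_add[OF uv] e xS by (simp add: l_distr a_ac)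
        then have "f (u \<oplus>\<^bsub>L\<^esub> v) = ?n s +> (c \<oplus> d)"
          unfolding f_def using e by (intro coset[of "j \<oplus> k"]) auto
        also have "\<dots> = f u \<oplus>\<^bsub>?Q\<^esub> f v"
          using e n.a_rcos_sum[OF e(2,5)] coset[OF e(1,2,3)] coset[OF e(4,5,6)]
          by (simp add: f_def quotient_module_def cQ)
        finally show ?thesis .
      qed
      moreover have "f (a \<odot>\<^bsub>L\<^esub> v) = a \<odot>\<^bsub>?Q\<^esub> f v" if uv: "a \<in> carrier S" "v \<in> carrier L" for a v
      proof -
        obtain j c where e: "j \<in> J" "c \<in> carrier S" "g v = j \<oplus> c \<otimes> x" using gv uv by metis
        then have "j \<in> carrier S" using J.Icarr by auto
        then have "g (a \<odot>\<^bsub>L\<^esub> v) = a \<otimes> j \<oplus> (a \<otimes> c) \<otimes> x"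
          using L.g_smult[OF uv] e uv xS by (simp add: r_distr m_assoc)
        then have "f (a \<odot>\<^bsub>L\<^esub> v) = ?n s +> (a \<otimes> c)"
          unfolding f_def using e uv by (intro coset[of "a \<otimes> j"]) (auto simp: J.I_l_closed)
        also have "\<dots> = a \<odot>\<^bsub>?Q\<^esub> f v"
          using smult[OF uv(1) e(2)] coset[OF e(1,2,3)] by (simp add: f_def)
        finally show ?thesis .
      qed
      ultimately show ?thesis by (auto simp: module_hom_def)
    qed
    moreover have "carrier ?Q \<subseteq> f ` carrier L"
    proof
      fix C assume "C \<in> carrier ?Q"
      then obtain c where c: "c \<in> carrier S" "C = ?n s +> c"
        by (auto simp: quotient_module_def cQ A_RCOSETS_def' a_r_coset_def')
      have "c \<otimes> x \<in> I" using c I(2) I.I_l_closed by blast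
      then obtain v where v: "v \<in> carrier L" "g v = c \<otimes> x" using gI by (metis imageE)
      then have "f v = C" unfolding f_def c(2) using c xS by (intro coset[of \<zero>]) auto
      then show "C \<in> f ` carrier L" using v by blast
    qed
    ultimately have "auslander_delta S ?Q = 0"
      by (intro auslander_delta_eq_0[OF mcm nofree, of f]) (auto simp: module_hom_def)
    then show False using s(2) by simp
  qed
  then obtain f where f: "f \<in> I" "I \<subseteq> PIdl f"
    using L.free_summand_imp_principal gI by metis
  have fS: "f \<in> carrier S" using f I.Icarr by blast
  have le: "?n (s + t - 1) \<subseteq> Idl (set [f])"
    using sub f(2) cgenideal_eq_genideal[OF fS] by (auto simp: I_def)
  then have "system_of_parameters S [f]"
    using f Im dim by (auto simp: system_of_parameters_def one_enat_def)
  then show ?thesis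
    unfolding gen_loewy_length_def using le s(1) t
    by (intro Inf_lower imageI CollectI conjI exI[of _ "[f]"]) auto
qed

section \<open>Localization at a prime ideal\<close>

lemma sorted_wrt_psubset_last:
  "sorted_wrt (\<subset>) qs \<Longrightarrow> q \<in> set qs \<Longrightarrow> q \<subseteq> last qs"
  by (induction qs) auto

locale prime_localization = primeideal p R for p and R :: "('a, 'b) ring_scheme" (structure)
begin

abbreviation S where "S \<equiv> localization_at R p"
abbreviation frac where "frac \<equiv> fraction R (carrier R - p)"

lemma one_not_mem [simp]: "\<one> \<notin> p"
  using one_imp_carrier I_notcarr by auto

lemma mult_mem_iff [simp]:
  "\<lbrakk>s \<in> carrier R; t \<in> carrier R\<rbrakk> \<Longrightarrow> s \<otimes> t \<in> p \<longleftrightarrow> s \<in> p \<or> t \<in> p"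
  using I_prime I_l_closed I_r_closed by blast

lemma denominators:
  "\<one> \<in> carrier R - p"
  "\<lbrakk>s \<in> carrier R - p; t \<in> carrier R - p\<rbrakk> \<Longrightarrow> s \<otimes> t \<in> carrier R - p"
  using submonoid.one_closed[OF submonoid_complement] submonoid.m_closed[OF submonoid_complement]
  by auto

lemma frac_eq_iff:
  assumes "a \<in> carrier R" "s \<in> carrier R - p" "b \<in> carrier R" "t \<in> carrier R - p"
  shows "frac a s = frac b t \<longleftrightarrow> (\<exists>u \<in> carrier R - p. u \<otimes> (t \<otimes> a) = u \<otimes> (s \<otimes> b))"
proof
  assume eq: "frac a s = frac b t"
  have "(b, t) \<in> frac b t"
    unfolding fraction_def frac_rel_def using assms denominators(1) by auto
  then have "(b, t) \<in> frac a s" by (simp only: eq)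
  then show "\<exists>u \<in> carrier R - p. u \<otimes> (t \<otimes> a) = u \<otimes> (s \<otimes> b)"
    by (auto simp: fraction_def frac_rel_def)
next
  have sub: "frac a s \<subseteq> frac b t"
    if c: "a \<in> carrier R" "s \<in> carrier R - p" "b \<in> carrier R" "t \<in> carrier R - p"
    and u: "u \<in> carrier R - p" "u \<otimes> (t \<otimes> a) = u \<otimes> (s \<otimes> b)" for a s b t u
  proof
    fix z assume "z \<in> frac a s"
    then obtain d r w where z: "z = (d, r)" "d \<in> carrier R" "r \<in> carrier R - p"
      and w: "w \<in> carrier R - p" "w \<otimes> (r \<otimes> a) = w \<otimes> (s \<otimes> d)"
      by (auto simp: fraction_def frac_rel_def)
    have "(u \<otimes> w \<otimes> s) \<otimes> (r \<otimes> b) = (w \<otimes> r) \<otimes> (u \<otimes> (s \<otimes> b))"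
      using c z u(1) w(1) by (simp add: m_ac)
    also have "\<dots> = (u \<otimes> t) \<otimes> (w \<otimes> (r \<otimes> a))" unfolding u(2)[symmetric]
      using c z u(1) w(1) by (simp add: m_ac)
    also have "\<dots> = (u \<otimes> w \<otimes> s) \<otimes> (t \<otimes> d)" unfolding w(2)
      using c z u(1) w(1) by (simp add: m_ac)
    finally show "z \<in> frac b t"
      using c z denominators(2)[OF denominators(2)[OF u(1) w(1)] c(2)]
      unfolding fraction_def frac_rel_def by blast
  qed
  assume "\<exists>u \<in> carrier R - p. u \<otimes> (t \<otimes> a) = u \<otimes> (s \<otimes> b)"
  then obtain u where u: "u \<in> carrier R - p" "u \<otimes> (t \<otimes> a) = u \<otimes> (s \<otimes> b)" by blast
  then show "frac a s = frac b t"
    using sub[OF assms u] sub[OF assms(3,4,1,2) u(1) u(2)[symmetric]] by blast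
qed

lemma frac_eqI:
  assumes "a \<in> carrier R" "s \<in> carrier R - p" "b \<in> carrier R" "t \<in> carrier R - p" "t \<otimes> a = s \<otimes> b"
  shows "frac a s = frac b t"
  unfolding frac_eq_iff[OF assms(1-4)] assms(5) using denominators(1) by blast

sublocale S: cring "localization_at R p"
  unfolding localization_at_def by (rule localization_cring(1)[OF submonoid_complement])

lemma S_carrier: "carrier S = {frac a s | a s. a \<in> carrier R \<and> s \<in> carrier R - p}"
  unfolding localization_at_def by (rule localization_cring(2)[OF submonoid_complement])

lemma frac_closed [simp]: "\<lbrakk>a \<in> carrier R; s \<in> carrier R - p\<rbrakk> \<Longrightarrow> frac a s \<in> carrier S"
  unfolding S_carrier by blast

lemma frac_mult:
  "\<lbrakk>a \<in> carrier R; s \<in> carrier R - p; b \<in> carrier R; t \<in> carrier R - p\<rbrakk> \<Longrightarrow>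
    frac a s \<otimes>\<^bsub>S\<^esub> frac b t = frac (a \<otimes> b) (s \<otimes> t)"
  unfolding localization_at_def by (rule localization_cring(3)[OF submonoid_complement])

lemma frac_add:
  "\<lbrakk>a \<in> carrier R; s \<in> carrier R - p; b \<in> carrier R; t \<in> carrier R - p\<rbrakk> \<Longrightarrow>
    frac a s \<oplus>\<^bsub>S\<^esub> frac b t = frac (t \<otimes> a \<oplus> s \<otimes> b) (s \<otimes> t)"
  unfolding localization_at_def by (rule localization_cring(4)[OF submonoid_complement])

lemma S_one: "\<one>\<^bsub>S\<^esub> = frac \<one> \<one>" and S_zero: "\<zero>\<^bsub>S\<^esub> = frac \<zero> \<one>"
  by (simp_all add: localization_at_def localization_def)

lemma to_localization_at: "to_localization_at R p a = frac a \<one>"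
  by (simp add: to_localization_at_def)

definition extension where
  "extension I = {frac a s | a s. a \<in> I \<and> s \<in> carrier R - p}"

definition contraction where
  "contraction K = {a \<in> carrier R. frac a \<one> \<in> K}"

text \<open>The criterion does not mention \<open>s\<close>: membership of a fraction depends on its numerator only.\<close>

lemma frac_mem_extension:
  assumes I: "ideal I R" and a: "a \<in> carrier R" "s \<in> carrier R - p"
  shows "frac a s \<in> extension I \<longleftrightarrow> (\<exists>u \<in> carrier R - p. u \<otimes> a \<in> I)"
proof
  interpret I: ideal I R by fact
  assume "frac a s \<in> extension I"
  then obtain b t where b: "frac a s = frac b t" "b \<in> I" "t \<in> carrier R - p"
    by (auto simp: extension_def)
  then obtain u where u: "u \<in> carrier R - p" "u \<otimes> (t \<otimes> a) = u \<otimes> (s \<otimes> b)"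
    using frac_eq_iff[OF a I.Icarr b(3)] by blast
  have "(u \<otimes> t) \<otimes> a = u \<otimes> (s \<otimes> b)" using u a b by (simp add: m_assoc)
  also have "\<dots> \<in> I" using u a b by (simp add: I.I_l_closed)
  finally show "\<exists>u \<in> carrier R - p. u \<otimes> a \<in> I" using denominators(2) u(1) b(3) by blast
next
  interpret I: ideal I R by fact
  assume "\<exists>u \<in> carrier R - p. u \<otimes> a \<in> I"
  then obtain u where u: "u \<in> carrier R - p" "u \<otimes> a \<in> I" by blast
  have "frac a s = frac (u \<otimes> a) (u \<otimes> s)"
    by (rule frac_eqI) (use a u denominators(2)[OF u(1) a(2)] in \<open>auto simp: m_ac\<close>)
  then show "frac a s \<in> extension I" using u a denominators(2) unfolding extension_def by blast
qed

lemma extension_ideal: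
  assumes "ideal I R"
  shows "ideal (extension I) S"
proof (intro idealI subgroup.intro)
  interpret I: ideal I R by fact
  show "extension I \<subseteq> carrier (add_monoid S)"
    using I.Icarr by (auto simp: extension_def)
  show "ring S" by (rule S.ring_axioms)
  have "frac \<zero> \<one> \<in> extension I"
    using denominators(1) I.zero_closed unfolding extension_def by blast
  then show "\<one>\<^bsub>add_monoid S\<^esub> \<in> extension I" by (simp add: S_zero)
  have mult: "y \<otimes>\<^bsub>S\<^esub> z \<in> extension I" if yz: "y \<in> carrier S" "z \<in> extension I" for y z
  proof -
    obtain a s b t where e: "y = frac a s" "a \<in> carrier R" "s \<in> carrier R - p"
      "z = frac b t" "b \<in> I" "t \<in> carrier R - p"
      using yz unfolding extension_def S_carrier by blast
    then have "y \<otimes>\<^bsub>S\<^esub> z = frac (a \<otimes> b) (s \<otimes> t)" by (simp only: frac_mult I.Icarr)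
    then show ?thesis
      using I.I_l_closed[OF e(5,2)] denominators(2)[OF e(3,6)] unfolding extension_def by blast
  qed
  show "y \<otimes>\<^bsub>S\<^esub> z \<in> extension I" if "z \<in> extension I" "y \<in> carrier S" for y z
    using mult that by blast
  show "z \<otimes>\<^bsub>S\<^esub> y \<in> extension I" if "z \<in> extension I" "y \<in> carrier S" for y z
  proof -
    have "z \<in> carrier S" using that(1) I.Icarr by (auto simp: extension_def)
    then show ?thesis using mult[OF that(2,1)] that S.m_comm by simp
  qed
  show "inv\<^bsub>add_monoid S\<^esub> z \<in> extension I" if "z \<in> extension I" for z
  proof -
    have z: "z \<in> carrier S" using that I.Icarr by (auto simp: extension_def)
    then have "\<ominus>\<^bsub>S\<^esub> z = (\<ominus>\<^bsub>S\<^esub> \<one>\<^bsub>S\<^esub>) \<otimes>\<^bsub>S\<^esub> z" by (simp add: S.l_minus)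
    also have "\<dots> \<in> extension I" using that by (intro mult) auto
    finally show ?thesis by (simp only: a_inv_def)
  qed
  show "y \<otimes>\<^bsub>add_monoid S\<^esub> z \<in> extension I" if yz: "y \<in> extension I" "z \<in> extension I" for y z
  proof -
    obtain a s b t where e: "y = frac a s" "a \<in> I" "s \<in> carrier R - p"
      "z = frac b t" "b \<in> I" "t \<in> carrier R - p"
      using yz unfolding extension_def by blast
    then have "y \<otimes>\<^bsub>add_monoid S\<^esub> z = frac (t \<otimes> a \<oplus> s \<otimes> b) (s \<otimes> t)"
      using frac_add[OF I.Icarr[OF e(2)] e(3) I.Icarr[OF e(5)] e(6)] by simp
    moreover have "t \<otimes> a \<oplus> s \<otimes> b \<in> I" using e by (simp add: I.I_l_closed)
    ultimately show ?thesis using denominators(2)[OF e(3,6)] unfolding extension_def by blast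
  qed
qed

lemma contraction_ideal:
  assumes "ideal K S"
  shows "ideal (contraction K) R"
proof (intro idealI subgroup.intro)
  interpret K: ideal K S by fact
  show "ring R" by (rule ring_axioms)
  show "contraction K \<subseteq> carrier (add_monoid R)" by (auto simp: contraction_def)
  show "\<one>\<^bsub>add_monoid R\<^esub> \<in> contraction K"
    using K.zero_closed by (simp add: contraction_def S_zero)
  have mult: "a \<otimes> b \<in> contraction K" if "a \<in> carrier R" "b \<in> contraction K" for a b
    using that K.I_l_closed[of "frac b \<one>" "frac a \<one>"] frac_mult[of a \<one> b \<one>]
    by (simp add: contraction_def)
  show "b \<otimes> a \<in> contraction K" if "a \<in> contraction K" "b \<in> carrier R" for a b
    using mult that by blast
  show "a \<otimes> b \<in> contraction K" if "a \<in> contraction K" "b \<in> carrier R" for a b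
    using mult[OF that(2,1)] that by (simp add: contraction_def m_comm)
  show "inv\<^bsub>add_monoid R\<^esub> a \<in> contraction K" if "a \<in> contraction K" for a
  proof -
    have "a \<in> carrier R" using that by (simp add: contraction_def)
    then have "inv\<^bsub>add_monoid R\<^esub> a = (\<ominus> \<one>) \<otimes> a" by (simp add: l_minus flip: a_inv_def)
    then show ?thesis using mult[of "\<ominus> \<one>" a] that by simp
  qed
  show "a \<otimes>\<^bsub>add_monoid R\<^esub> b \<in> contraction K" if "a \<in> contraction K" "b \<in> contraction K" for a b
    using that frac_add[of a \<one> b \<one>] K.a_closed[of "frac a \<one>" "frac b \<one>"]
    by (simp add: contraction_def)
qed

lemma extension_mono: "I \<subseteq> J \<Longrightarrow> extension I \<subseteq> extension J"
  by (auto simp: extension_def)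

lemma contraction_mono: "K \<subseteq> L \<Longrightarrow> contraction K \<subseteq> contraction L"
  by (auto simp: contraction_def)

lemma subset_contraction_extension:
  assumes "ideal I R"
  shows "I \<subseteq> contraction (extension I)"
  using ideal.Icarr[OF assms] denominators(1) unfolding contraction_def extension_def by blast

lemma extension_contraction:
  assumes "ideal K S"
  shows "extension (contraction K) = K"
proof (intro equalityI subsetI)
  interpret K: ideal K S by fact
  fix z assume "z \<in> extension (contraction K)"
  then obtain a s where z: "z = frac a s" "a \<in> carrier R" "frac a \<one> \<in> K" "s \<in> carrier R - p"
    by (auto simp: extension_def contraction_def)
  have "z = frac \<one> s \<otimes>\<^bsub>S\<^esub> frac a \<one>" using z frac_mult[of \<one> s a \<one>] by simp
  then show "z \<in> K" using z by (simp add: K.I_l_closed)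
next
  interpret K: ideal K S by fact
  fix z assume z: "z \<in> K"
  then obtain a s where e: "z = frac a s" "a \<in> carrier R" "s \<in> carrier R - p"
    using K.Icarr unfolding S_carrier by blast
  have "frac a \<one> = frac (s \<otimes> a) (\<one> \<otimes> s)"
    by (rule frac_eqI) (use e denominators(1) in auto)
  also have "\<dots> = frac s \<one> \<otimes>\<^bsub>S\<^esub> z" using e frac_mult[of s \<one> a s] by simp
  also have "\<dots> \<in> K" using z e by (simp add: K.I_l_closed)
  finally show "z \<in> extension (contraction K)" using e unfolding extension_def contraction_def by blast
qed

text \<open>This identifies the generated ideals in the definition of the symbolic powers with
  \<open>extension\<close>, and transports finite generation to the localization.\<close>

lemma genideal_to_localization:
  assumes "A \<subseteq> carrier R"
  shows "Idl\<^bsub>S\<^esub> ((\<lambda>a. frac a \<one>) ` A) = extension (Idl A)"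
proof
  have sub: "(\<lambda>a. frac a \<one>) ` A \<subseteq> carrier S" using assms by auto
  note K = S.genideal_ideal[OF sub]
  have "A \<subseteq> contraction (Idl\<^bsub>S\<^esub> ((\<lambda>a. frac a \<one>) ` A))"
    using S.genideal_self[OF sub] assms by (auto simp: contraction_def)
  then have "Idl A \<subseteq> contraction (Idl\<^bsub>S\<^esub> ((\<lambda>a. frac a \<one>) ` A))"
    by (rule genideal_minimal[OF contraction_ideal[OF K]])
  then show "extension (Idl A) \<subseteq> Idl\<^bsub>S\<^esub> ((\<lambda>a. frac a \<one>) ` A)"
    using extension_mono extension_contraction[OF K] by blast
  have "(\<lambda>a. frac a \<one>) ` A \<subseteq> extension (Idl A)"
    using genideal_self[OF assms] denominators(1) unfolding extension_def by blast
  then show "Idl\<^bsub>S\<^esub> ((\<lambda>a. frac a \<one>) ` A) \<subseteq> extension (Idl A)"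
    by (rule S.genideal_minimal[OF extension_ideal[OF genideal_ideal[OF assms]]])
qed

lemma extension_ideal_prod:
  assumes I: "ideal I R" and J: "ideal J R"
  shows "extension (I \<cdot>\<^bsub>R\<^esub> J) = extension I \<cdot>\<^bsub>S\<^esub> extension J"
proof
  note prod = S.ideal_prod_is_ideal[OF extension_ideal[OF I] extension_ideal[OF J]]
  have "I \<cdot>\<^bsub>R\<^esub> J \<subseteq> contraction (extension I \<cdot>\<^bsub>S\<^esub> extension J)"
  proof
    fix z assume "z \<in> I \<cdot>\<^bsub>R\<^esub> J"
    then show "z \<in> contraction (extension I \<cdot>\<^bsub>S\<^esub> extension J)"
    proof induction
      case (prod i j)
      then have c: "i \<in> carrier R" "j \<in> carrier R" using I J ideal.Icarr by metis+
      have "frac i \<one> \<in> extension I" "frac j \<one> \<in> extension J"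
        using prod denominators(1) unfolding extension_def by blast+
      then have "frac i \<one> \<otimes>\<^bsub>S\<^esub> frac j \<one> \<in> extension I \<cdot>\<^bsub>S\<^esub> extension J"
        by (rule ideal_prod.prod)
      then show ?case using c frac_mult[of i \<one> j \<one>] by (simp add: contraction_def)
    next
      case (sum y z)
      then show ?case
        using additive_subgroup.a_closed ideal.axioms(1)[OF contraction_ideal[OF S.ideal_prod_is_ideal[OF extension_ideal[OF I] extension_ideal[OF J]]]]
        by metis
    qed
  qed
  then show "extension (I \<cdot>\<^bsub>R\<^esub> J) \<subseteq> extension I \<cdot>\<^bsub>S\<^esub> extension J"
    using extension_mono extension_contraction[OF prod] by blast
  note ext = extension_ideal[OF ideal_prod_is_ideal[OF I J]]
  show "extension I \<cdot>\<^bsub>S\<^esub> extension J \<subseteq> extension (I \<cdot>\<^bsub>R\<^esub> J)"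
  proof
    fix z assume "z \<in> extension I \<cdot>\<^bsub>S\<^esub> extension J"
    then show "z \<in> extension (I \<cdot>\<^bsub>R\<^esub> J)"
    proof induction
      case (prod y z)
      then obtain a s b t where e: "y = frac a s" "a \<in> I" "s \<in> carrier R - p"
        "z = frac b t" "b \<in> J" "t \<in> carrier R - p"
        unfolding extension_def by blast
      have "y \<otimes>\<^bsub>S\<^esub> z = frac (a \<otimes> b) (s \<otimes> t)"
        unfolding e(1,4) using e I J by (intro frac_mult) (auto intro: ideal.Icarr)
      then show ?case
        using ideal_prod.prod[OF e(2,5), of R] denominators(2)[OF e(3,6)] unfolding extension_def by blast
    next
      case (sum y z)
      then show ?case using additive_subgroup.a_closed[OF ideal.axioms(1)[OF ext]] by blast
    qed
  qed
qed

lemma extension_carrier: "extension (carrier R) = carrier S"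
  by (auto simp: extension_def S_carrier)

lemma extension_ideal_power:
  assumes "ideal I R"
  shows "extension (ideal_power R I n) = ideal_power S (extension I) n"
proof (induction n)
  case 0
  show ?case by (simp add: ideal_power_0 S.ideal_power_0 extension_carrier)
next
  case (Suc n)
  have "extension (ideal_power R I (n + 1)) = ideal_power S (extension I) (n + 1)"
    using Suc.IH ideal_power_ideal[OF assms] assms extension_ideal[OF assms]
    by (simp only: ideal_power_add[OF assms] ideal_power_1 S.ideal_power_add S.ideal_power_1
        extension_ideal_prod)
  then show ?case by simp
qed

lemma unit_if_not_mem_extension:
  assumes "z \<in> carrier S" "z \<notin> extension p"
  shows "z \<in> Units S"
proof -
  obtain a s where z: "z = frac a s" "a \<in> carrier R" "s \<in> carrier R - p"
    using assms unfolding S_carrier by blast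
  then have a: "a \<in> carrier R - p" using assms(2) unfolding extension_def by blast
  have "z \<otimes>\<^bsub>S\<^esub> frac s a = frac (a \<otimes> s) (s \<otimes> a)"
    using frac_mult[of a s s a] z a by simp
  also have "\<dots> = \<one>\<^bsub>S\<^esub>" unfolding S_one
    by (rule frac_eqI) (use z a denominators in \<open>auto simp: m_comm\<close>)
  finally have "z \<otimes>\<^bsub>S\<^esub> frac s a = \<one>\<^bsub>S\<^esub>" .
  moreover have "frac s a \<in> carrier S" using z a by simp
  ultimately show ?thesis using assms(1) S.m_comm[of z "frac s a"] unfolding Units_def by auto
qed

lemma one_not_mem_extension: "\<one>\<^bsub>S\<^esub> \<notin> extension p"
proof
  assume "\<one>\<^bsub>S\<^esub> \<in> extension p"
  then obtain u where "u \<in> carrier R - p" "u \<otimes> \<one> \<in> p"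
    using frac_mem_extension[OF is_ideal one_closed denominators(1)] S_one by auto
  then show False by simp
qed

lemma proper_ideal_subset:
  assumes "ideal K S" "K \<noteq> carrier S"
  shows "K \<subseteq> extension p"
proof
  interpret K: ideal K S by fact
  fix z assume z: "z \<in> K"
  show "z \<in> extension p"
  proof (rule ccontr)
    assume "\<not> ?thesis"
    then have "z \<in> Units S" using unit_if_not_mem_extension K.Icarr[OF z] by blast
    then have "\<one>\<^bsub>S\<^esub> \<in> K" using K.I_r_closed[OF z, of "inv\<^bsub>S\<^esub> z"] S.Units_r_inv by simp
    then show False using K.one_imp_carrier assms by blast
  qed
qed

lemma extension_maximal: "maximalideal (extension p) S"
proof (rule maximalidealI[OF extension_ideal[OF is_ideal]])
  show "carrier S \<noteq> extension p" using one_not_mem_extension by auto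
  show "K = extension p \<or> K = carrier S" if "ideal K S" "extension p \<subseteq> K" for K
    using proper_ideal_subset[OF that(1)] that by blast
qed

lemma maximal_unique:
  assumes "maximalideal m S"
  shows "m = extension p"
proof -
  interpret m: maximalideal m S by fact
  have ext: "ideal (extension p) S" by (rule extension_ideal[OF is_ideal])
  have "m \<subseteq> extension p" using proper_ideal_subset[OF m.is_ideal] m.I_notcarr by blast
  then have "extension p = m \<or> extension p = carrier S"
    using m.I_maximal[OF ext] ideal.Icarr[OF ext] by blast
  then show ?thesis using maximalideal.I_notcarr[OF extension_maximal] by blast
qed

lemma max_ideal_localization: "max_ideal S = extension p"
  unfolding max_ideal_def using extension_maximal maximal_unique by (rule the_equality)

lemma noeth_local_ring_localization:
  assumes "noetherian_ring R"
  shows "noeth_local_ring S"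
proof -
  interpret noetherian_ring R by fact
  have "\<exists>A \<subseteq> carrier S. finite A \<and> K = Idl\<^bsub>S\<^esub> A" if K: "ideal K S" for K
  proof -
    obtain A where A: "A \<subseteq> carrier R" "finite A" "contraction K = Idl A"
      using finetely_gen[OF contraction_ideal[OF K]] by blast
    have "K = Idl\<^bsub>S\<^esub> ((\<lambda>a. frac a \<one>) ` A)"
      using genideal_to_localization[OF A(1)] extension_contraction[OF K] A(3) by simp
    moreover have "(\<lambda>a. frac a \<one>) ` A \<subseteq> carrier S" using A by auto
    ultimately show ?thesis using A(2) by blast
  qed
  then have "noetherian_ring S" by (rule S.noetherian_ringI)
  then show ?thesis
    using S.is_cring extension_maximal maximal_unique unfolding noeth_local_ring_def by blast
qed

lemma contraction_extension_prime:
  assumes q: "primeideal q R" "q \<subseteq> p"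
  shows "contraction (extension q) = q"
proof
  interpret q: primeideal q R by fact
  show "contraction (extension q) \<subseteq> q"
  proof
    fix a assume "a \<in> contraction (extension q)"
    then have a: "a \<in> carrier R" "frac a \<one> \<in> extension q" by (simp_all add: contraction_def)
    then obtain u where "u \<in> carrier R - p" "u \<otimes> a \<in> q"
      using frac_mem_extension[OF q.is_ideal a(1) denominators(1)] by blast
    then show "a \<in> q" using q.I_prime a q(2) by blast
  qed
qed (rule subset_contraction_extension[OF primeideal.axioms(1)[OF q(1)]])

lemma extension_prime:
  assumes q: "primeideal q R" "q \<subseteq> p"
  shows "primeideal (extension q) S"
proof (rule primeidealI[OF _ S.is_cring])
  interpret q: primeideal q R by fact
  show "ideal (extension q) S" by (rule extension_ideal[OF q.is_ideal])
  show "carrier S \<noteq> extension q" using one_not_mem_extension extension_mono[OF q(2)] by auto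
  fix y z assume "y \<in> carrier S" "z \<in> carrier S" and yz: "y \<otimes>\<^bsub>S\<^esub> z \<in> extension q"
  then obtain a s b t where e: "y = frac a s" "a \<in> carrier R" "s \<in> carrier R - p"
    "z = frac b t" "b \<in> carrier R" "t \<in> carrier R - p"
    unfolding S_carrier by blast
  have "frac (a \<otimes> b) (s \<otimes> t) \<in> extension q" using yz frac_mult[OF e(2,3,5,6)] e by simp
  then obtain u where u: "u \<in> carrier R - p" "u \<otimes> (a \<otimes> b) \<in> q"
    using frac_mem_extension[OF q.is_ideal m_closed[OF e(2,5)] denominators(2)[OF e(3,6)]] by blast
  then have "u \<notin> q" using q(2) by blast
  then have "a \<otimes> b \<in> q" using q.I_prime[of u "a \<otimes> b"] u e by blast
  then have "a \<in> q \<or> b \<in> q" using q.I_prime e by blast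
  then show "y \<in> extension q \<or> z \<in> extension q" using e unfolding extension_def by blast
qed

lemma contraction_prime:
  assumes K: "primeideal K S"
  shows "primeideal (contraction K) R" "contraction K \<subseteq> p"
proof -
  interpret K: primeideal K S by fact
  have "contraction K \<subseteq> contraction (extension p)"
    using proper_ideal_subset[OF K.is_ideal] K.I_notcarr by (intro contraction_mono) auto
  then show sub: "contraction K \<subseteq> p" using contraction_extension_prime[OF primeideal_axioms] by simp
  show "primeideal (contraction K) R"
  proof (rule primeidealI[OF contraction_ideal[OF K.is_ideal] is_cring])
    show "carrier R \<noteq> contraction K" using sub denominators(1) by blast
    fix a b assume ab: "a \<in> carrier R" "b \<in> carrier R" "a \<otimes> b \<in> contraction K"
    then have "frac a \<one> \<otimes>\<^bsub>S\<^esub> frac b \<one> \<in> K"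
      using frac_mult[of a \<one> b \<one>] by (simp add: contraction_def)
    then show "a \<in> contraction K \<or> b \<in> contraction K"
      using K.I_prime[of "frac a \<one>" "frac b \<one>"] ab by (simp add: contraction_def)
  qed
qed

text \<open>Extension and contraction are inverse, strictly monotone bijections between the primes inside
  \<open>p\<close> and the primes of the localization. A chain of contracted primes need not end in \<open>p\<close>; if
  it does not, appending \<open>p\<close> only makes it longer.\<close>

lemma krull_dim_localization: "krull_dim S = height R p"
proof (rule antisym)
  have mono: "contraction K \<subset> contraction L" if "K \<subset> L" "primeideal K S" "primeideal L S" for K L
  proof -
    have "extension (contraction K) \<noteq> extension (contraction L)"
      using that by (auto simp: extension_contraction primeideal.axioms(1))
    then show ?thesis using that(1) contraction_mono[of K L] by auto
  qed
  have bound: "enat (length Ks - 1) \<le> height R p" if Ks: "prime_chain S Ks" for Ks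
  proof -
    define cs where "cs = map contraction Ks"
    have cs: "cs \<noteq> []" "\<And>q. q \<in> set cs \<Longrightarrow> primeideal q R \<and> q \<subseteq> p" "length cs = length Ks"
      using Ks contraction_prime by (auto simp: cs_def prime_chain_def)
    have sorted: "sorted_wrt (\<subset>) cs"
      unfolding cs_def sorted_wrt_map
      by (rule sorted_wrt_mono_rel[of _ "(\<subset>)"]) (use Ks mono in \<open>auto simp: prime_chain_def\<close>)
    have le: "enat (length qs - 1) \<le> height R p" if "prime_chain R qs" "last qs = p" for qs
      unfolding height_def using that by (intro SUP_upper) simp
    show ?thesis
    proof (cases "last cs = p")
      case True
      then show ?thesis using le[of cs] cs sorted by (simp add: prime_chain_def)
    next
      case False
      have "q \<subset> p" if q: "q \<in> set cs" for q
      proof -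
        have "q \<subseteq> last cs" by (rule sorted_wrt_psubset_last[OF sorted q])
        then show ?thesis using cs(2)[of "last cs"] cs(1) False by auto
      qed
      then have "prime_chain R (cs @ [p])"
        using cs sorted primeideal_axioms by (auto simp: prime_chain_def sorted_wrt_append)
      then have "enat (length cs) \<le> height R p" using le[of "cs @ [p]"] by simp
      then show ?thesis using cs(3) by (metis diff_le_self enat_ord_simps(1) order_trans)
    qed
  qed
  show "krull_dim S \<le> height R p"
    unfolding krull_dim_def using bound by (intro SUP_least) simp
  show "height R p \<le> krull_dim S"
    unfolding height_def
  proof (rule SUP_least)
    fix qs assume "qs \<in> {qs. prime_chain R qs \<and> last qs = p}"
    then have qs: "prime_chain R qs" "last qs = p" by auto
    have sub: "q \<subseteq> p" if "q \<in> set qs" for q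
      using qs sorted_wrt_psubset_last[OF _ that] by (simp add: prime_chain_def)
    have "prime_chain S (map extension qs)"
      unfolding prime_chain_def
    proof (intro conjI)
      show "sorted_wrt (\<subset>) (map extension qs)"
        unfolding sorted_wrt_map
      proof (rule sorted_wrt_mono_rel[of _ "(\<subset>)"])
        fix q r assume qr: "q \<in> set qs" "r \<in> set qs" "q \<subset> r"
        then have "contraction (extension q) \<noteq> contraction (extension r)"
          using sub qs(1) by (simp add: contraction_extension_prime prime_chain_def)
        then show "extension q \<subset> extension r"
          using extension_mono[of q r] qr(3) by auto
      qed (use qs in \<open>simp add: prime_chain_def\<close>)
    qed (use qs sub extension_prime in \<open>auto simp: prime_chain_def\<close>)
    from prime_chain_le_krull_dim[OF this] show "enat (length qs - 1) \<le> krull_dim S" by simp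
  qed
qed

lemma symbolic_power_eq_contraction:
  "symbolic_power R p n = contraction (ideal_power S (max_ideal S) n)"
proof -
  note pn = ideal_power_ideal[OF is_ideal, of n]
  have sub: "ideal_power R p n \<subseteq> carrier R" using ideal.Icarr[OF pn] by blast
  have "Idl (ideal_power R p n) = ideal_power R p n"
    using genideal_self[OF sub] genideal_minimal[OF pn order_refl] by blast
  then show ?thesis
    using genideal_to_localization[OF sub] extension_ideal_power[OF is_ideal, of n]
    by (simp add: symbolic_power_def contraction_def to_localization_at max_ideal_localization
        image_def)
qed

end

section \<open>Symbolic powers and multiplication by \<open>x\<close>\<close>

text \<open>Injectivity on cosets, applied to the coset of \<open>a\<close> and the zero coset.\<close>

lemma (in ring) induced_mult_injD:
  assumes I: "ideal I R" and J: "ideal J R" and H: "\<zero> \<in> H" "H \<subseteq> carrier R" and x: "x \<in> carrier R"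
    and sub: "\<And>b. b \<in> I \<Longrightarrow> x \<otimes> b \<in> J"
    and inj: "inj_on (induced_mult R x J) (carrier (R\<lparr>carrier := H\<rparr> A_Mod I))"
    and a: "a \<in> H" "x \<otimes> a \<in> J"
  shows "a \<in> I"
proof -
  interpret I: ideal I R by fact
  interpret J: ideal J R by fact
  have aR: "a \<in> carrier R" using a H by blast
  have mem: "I +> b \<in> carrier (R\<lparr>carrier := H\<rparr> A_Mod I)" if "b \<in> H" for b
    using that by (auto simp: A_FactGroup_def' A_RCOSETS_def' a_r_coset_def')
  have "induced_mult R x J (I +> a) = J +> x \<otimes> a"
    by (rule induced_mult_coset[OF I J x aR sub])
  also have "\<dots> = J +> x \<otimes> \<zero>"
    using J.a_rcos_const[OF a(2)] J.a_rcos_const[OF J.zero_closed] x by simp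
  also have "\<dots> = induced_mult R x J (I +> \<zero>)"
    by (rule induced_mult_coset[OF I J x zero_closed sub, symmetric])
  finally have "I +> a = I +> \<zero>"
    by (rule inj_onD[OF inj _ mem[OF a(1)] mem[OF H(1)]])
  then have "a \<ominus> \<zero> \<in> I"
    using quotient_eq_iff_same_a_r_cos[OF I aR zero_closed] by simp
  then show ?thesis using aR by (simp add: a_minus_def)
qed

theorem proposition2p22:
  fixes R :: "('a, 'b) ring_scheme" (structure) and p :: "'a set" and x :: 'a and s t :: nat
  assumes "cohen_macaulay_local_ring R"
    and "primeideal p R"
    and "height R p = 1"
    and "auslander_index (localization_at R p) \<noteq> \<infinity>"
    and "enat s = auslander_index (localization_at R p)"
    and "t \<ge> 1"
    and "x \<in> symbolic_power R p t - symbolic_power R p (t + 1)"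
    and "nonzerodivisor_on (regular_module R) x"
    and "\<forall>i. 1 \<le> i \<and> i \<le> s \<longrightarrow>
      inj_on (induced_mult R x (symbolic_power R p (i + t)))
        (carrier (R\<lparr>carrier := symbolic_power R p (i - 1)\<rparr> A_Mod symbolic_power R p i))"
  shows "gen_loewy_length (localization_at R p) \<le> auslander_index (localization_at R p) + enat t - 1"
proof -
  interpret primeideal p R by fact
  interpret prime_localization p R by unfold_locales
  have noeth: "noetherian_ring R"
    using assms(1) by (simp add: cohen_macaulay_local_ring_def noeth_local_ring_def)
  let ?n = "ideal_power S (max_ideal S)"
  have n: "ideal (max_ideal S) S"
    unfolding max_ideal_localization by (rule extension_ideal[OF is_ideal])
  note npow = S.ideal_power_ideal[OF n]
  have sym: "a \<in> symbolic_power R p k \<longleftrightarrow> a \<in> carrier R \<and> frac a \<one> \<in> ?n k" for a k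
    by (simp add: symbolic_power_eq_contraction contraction_def)
  have sym_ideal: "ideal (symbolic_power R p k) R" for k
    unfolding symbolic_power_eq_contraction by (rule contraction_ideal[OF npow])
  have x: "x \<in> carrier R" "frac x \<one> \<in> ?n t" using assms(7) by (auto simp: sym)
  have x_mult: "x \<otimes> b \<in> symbolic_power R p (k + t)" if "b \<in> symbolic_power R p k" for b k
    using that x S.ideal_power_mult[OF n, of "frac b \<one>" k "frac x \<one>" t] frac_mult[of b \<one> x \<one>]
    by (simp add: sym m_comm)
  \<comment> \<open>Each injectivity hypothesis raises the symbolic power known to contain \<open>a\<close> by one.\<close>
  have colon: "i \<le> s \<Longrightarrow> a \<in> symbolic_power R p i"
    if a: "a \<in> carrier R" "x \<otimes> a \<in> symbolic_power R p (s + t)" for a i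
  proof (induction i)
    case 0
    show ?case using a by (simp add: sym S.ideal_power_0)
  next
    case (Suc i)
    have "?n (s + t) \<subseteq> ?n (Suc i + t)"
      using Suc.prems by (intro S.ideal_power_decreasing[OF n]) simp
    then have "x \<otimes> a \<in> symbolic_power R p (Suc i + t)" using a x by (auto simp: sym)
    moreover have "inj_on (induced_mult R x (symbolic_power R p (Suc i + t)))
        (carrier (R\<lparr>carrier := symbolic_power R p i\<rparr> A_Mod symbolic_power R p (Suc i)))"
      using assms(9)[rule_format, of "Suc i"] Suc.prems by simp
    moreover have "a \<in> symbolic_power R p i" using Suc by simp
    moreover have "\<zero> \<in> symbolic_power R p i" "symbolic_power R p i \<subseteq> carrier R"
      using additive_subgroup.zero_closed[OF ideal.axioms(1)[OF sym_ideal]]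
        ideal.Icarr[OF sym_ideal] by blast+
    ultimately show ?case
      using induced_mult_injD[OF sym_ideal sym_ideal _ _ x(1) x_mult] by blast
  qed
  have "gen_loewy_length S \<le> enat (s + t - 1)"
  proof (rule gen_loewy_length_le_index)
    show "noeth_local_ring S" by (rule noeth_local_ring_localization[OF noeth])
    show "krull_dim S = 1" using assms(3) by (simp add: krull_dim_localization)
    show "auslander_index S = enat s" using assms(5) by simp
    show "frac x \<one> \<in> max_ideal S"
      using x(2) S.ideal_power_decreasing[OF n assms(6)] by (simp only: S.ideal_power_1[OF n]) blast
  next
    fix c assume "c \<in> carrier S" and c: "frac x \<one> \<otimes>\<^bsub>S\<^esub> c = \<zero>\<^bsub>S\<^esub>"
    then obtain a u where a: "c = frac a u" "a \<in> carrier R" "u \<in> carrier R - p"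
      unfolding S_carrier by blast
    then have "frac (x \<otimes> a) u = frac \<zero> \<one>"
      using c frac_mult[of x \<one> a u] x(1) by (simp add: S_zero)
    then obtain v where v: "v \<in> carrier R - p" "v \<otimes> (\<one> \<otimes> (x \<otimes> a)) = v \<otimes> (u \<otimes> \<zero>)"
      using frac_eq_iff[of "x \<otimes> a" u \<zero> \<one>] a x(1) by auto
    then have "x \<otimes> (v \<otimes> a) = \<zero>" using a x(1) by (simp add: m_ac)
    then have "v \<otimes> a = \<zero>"
      using assms(8) v(1) a(2) by (simp add: nonzerodivisor_on_def)
    then show "c = \<zero>\<^bsub>S\<^esub>"
      unfolding a(1) S_zero using a v(1) frac_eq_iff[of a u \<zero> \<one>] by auto
  next
    fix r assume "r \<in> carrier S" and r: "frac x \<one> \<otimes>\<^bsub>S\<^esub> r \<in> ?n (s + t)"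
    then obtain a u where a: "r = frac a u" "a \<in> carrier R" "u \<in> carrier R - p"
      unfolding S_carrier by blast
    have change: "frac b v \<in> ?n k \<longleftrightarrow> frac b w \<in> ?n k"
      if "b \<in> carrier R" "v \<in> carrier R - p" "w \<in> carrier R - p" for b v w k
      using that frac_mem_extension[OF contraction_ideal[OF npow[of k]]]
      by (simp add: extension_contraction[OF npow])
    have "frac (x \<otimes> a) u \<in> ?n (s + t)"
      using r a x(1) frac_mult[of x \<one> a u] by simp
    then have "x \<otimes> a \<in> symbolic_power R p (s + t)"
      using change[of "x \<otimes> a" u \<one>] a x(1) by (simp add: sym)
    then have "a \<in> symbolic_power R p s" using colon[OF a(2)] by blast
    then show "r \<in> ?n s" using change[of a u \<one>] a by (simp add: sym)
  qed (rule assms(6))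
  then show ?thesis by (simp add: one_enat_def flip: assms(5))
qed

end
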